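(* Let $\delta$ be a positive integer and let $G=(V,E)$ be a 2-connected simple graph. The polytope $B(M(G))$ is $\delta$-Gorenstein if and only if there exists a function $w:E\to\{1,\delta-1\}$ with $w(e)=1$ whenever $G\setminus e$ is 2-connected and $w(e)=\delta-1$ whenever $G/e$ is 2-connected, such that (1) $w(E)=\delta(|V|-1)$, and (2) $w(E(S))+1=\delta(|S|-1)$ for every good flat $S\subset V$.
   Context: $B(M(G))\subset\mathbb{R}^E$ is the convex hull of indicator vectors of spanning forests (bases of the graphic matroid) of $G$. For a normal lattice polytope $P$ and positive integer $\delta$, $P$ is $\delta$-Gorenstein if, regarding $P$ as full-dimensional in the affine lattice it spans, there is a lattice point $v\in\delta P$ such that every facet of the cone generated by $P\times\{1\}$ has reduced equation $h$ (primitive integral linear form, nonnegative on the cone) with $h(v,\delta)=1$. $w(F)=\sum_{e\in F}w(e)$; $E(S)$ is the set of edges with both ends in $S$. A graph is 2-connected if connected, with at least two vertices and no cut vertex (a single edge counts as 2-connected). $G\setminus e$ is deletion, $G/e$ contraction. $S\subset V$ is a good flat if the induced subgraph $G|_S$ is 2-connected and the graph obtained from $G$ by contracting all edges of $E(S)$ is 2-connected. *)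

theory Defs
  imports "HOL-Analysis.Analysis" "HOL-Computational_Algebra.Group_Closure"
begin

section \<open>Graphs\<close>

text \<open>
  Multigraphs are needed because contraction of a simple graph can create parallel edges.
  \<open>ends G e\<close> is the set of end vertices of \<open>e\<close> (a singleton for a loop); it is only
  meaningful for \<open>e \<in> edges G\<close>. Keeping the names of the edges apart from their ends lets minors
  keep the edge names, and lets the edge set serve as the coordinate set of the polytope.
\<close>

record ('v, 'e) multigraph =
  verts :: "'v set"
  edges :: "'e set"
  ends :: "'e \<Rightarrow> 'v set"

definition simple_graph :: "('v, 'e) multigraph \<Rightarrow> bool" where
  "simple_graph G \<longleftrightarrow>
     finite (verts G) \<and> finite (edges G) \<and>
     (\<forall>e\<in>edges G. ends G e \<subseteq> verts G \<and> card (ends G e) = 2) \<and>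
     inj_on (ends G) (edges G)"

definition adjacent :: "('v, 'e) multigraph \<Rightarrow> 'v \<Rightarrow> 'v \<Rightarrow> bool" where
  "adjacent G u v \<longleftrightarrow> (\<exists>e\<in>edges G. ends G e = {u, v})"

definition connected_graph :: "('v, 'e) multigraph \<Rightarrow> bool" where
  "connected_graph G \<longleftrightarrow>
     verts G \<noteq> {} \<and> (\<forall>u\<in>verts G. \<forall>v\<in>verts G. (adjacent G)\<^sup>*\<^sup>* u v)"

definition delete_vertex :: "('v, 'e) multigraph \<Rightarrow> 'v \<Rightarrow> ('v, 'e) multigraph" where
  "delete_vertex G v =
     \<lparr>verts = verts G - {v}, edges = {e \<in> edges G. v \<notin> ends G e}, ends = ends G\<rparr>"

definition delete_edge :: "('v, 'e) multigraph \<Rightarrow> 'e \<Rightarrow> ('v, 'e) multigraph" where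
  "delete_edge G e = \<lparr>verts = verts G, edges = edges G - {e}, ends = ends G\<rparr>"

text \<open>\<open>edges_within G S\<close> is $E(S)$.\<close>

definition edges_within :: "('v, 'e) multigraph \<Rightarrow> 'v set \<Rightarrow> 'e set" where
  "edges_within G S = {e \<in> edges G. ends G e \<subseteq> S}"

definition induced_subgraph :: "('v, 'e) multigraph \<Rightarrow> 'v set \<Rightarrow> ('v, 'e) multigraph" where
  "induced_subgraph G S = \<lparr>verts = S, edges = edges_within G S, ends = ends G\<rparr>"

text \<open>
  Contracting the edges in \<open>F\<close> identifies the vertices of each connected component of the
  spanning subgraph with edge set \<open>F\<close>; the vertices of the contraction are these components.
\<close>

definition component :: "('v, 'e) multigraph \<Rightarrow> 'e set \<Rightarrow> 'v \<Rightarrow> 'v set" where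
  "component G F u = {v \<in> verts G. (adjacent (G\<lparr>edges := F\<rparr>))\<^sup>*\<^sup>* u v}"

definition contract :: "('v, 'e) multigraph \<Rightarrow> 'e set \<Rightarrow> ('v set, 'e) multigraph" where
  "contract G F =
     \<lparr>verts = component G F ` verts G,
      edges = edges G - F,
      ends = (\<lambda>e. component G F ` ends G e)\<rparr>"

definition cut_vertex :: "('v, 'e) multigraph \<Rightarrow> 'v \<Rightarrow> bool" where
  "cut_vertex G v \<longleftrightarrow> v \<in> verts G \<and> \<not> connected_graph (delete_vertex G v)"

definition two_connected :: "('v, 'e) multigraph \<Rightarrow> bool" where
  "two_connected G \<longleftrightarrow>
     connected_graph G \<and> 2 \<le> card (verts G) \<and> \<not> (\<exists>v. cut_vertex G v)"

definition good_flat :: "('v, 'e) multigraph \<Rightarrow> 'v set \<Rightarrow> bool" where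
  "good_flat G S \<longleftrightarrow>
     S \<subseteq> verts G \<and> two_connected (induced_subgraph G S) \<and>
     two_connected (contract G (edges_within G S))"

section \<open>The base polytope of the graphic matroid\<close>

text \<open>
  A cycle is a cyclic sequence of distinct vertices \<open>vs\<close> together with distinct edges \<open>es\<close> joining
  consecutive vertices; lengths 1 and 2 are loops and pairs of parallel edges.
\<close>

definition is_cycle :: "('v, 'e) multigraph \<Rightarrow> 'v list \<Rightarrow> 'e list \<Rightarrow> bool" where
  "is_cycle G vs es \<longleftrightarrow>
     vs \<noteq> [] \<and> length es = length vs \<and> distinct vs \<and> distinct es \<and>
     set vs \<subseteq> verts G \<and> set es \<subseteq> edges G \<and>
     (\<forall>i<length vs. ends G (es ! i) = {vs ! i, vs ! (Suc i mod length vs)})"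

definition forest :: "('v, 'e) multigraph \<Rightarrow> 'e set \<Rightarrow> bool" where
  "forest G F \<longleftrightarrow> F \<subseteq> edges G \<and> \<not> (\<exists>vs es. is_cycle G vs es \<and> set es \<subseteq> F)"

text \<open>Spanning forests are the inclusion-maximal forests, i.e. the bases of $M(G)$.\<close>

definition spanning_forest :: "('v, 'e) multigraph \<Rightarrow> 'e set \<Rightarrow> bool" where
  "spanning_forest G B \<longleftrightarrow> forest G B \<and> (\<forall>F. forest G F \<and> B \<subseteq> F \<longrightarrow> F = B)"

definition indicator_vec :: "'e set \<Rightarrow> real ^ 'e" where
  "indicator_vec A = (\<chi> e. indicator A e)"

definition base_polytope :: "('v, 'e::finite) multigraph \<Rightarrow> (real ^ 'e) set" where
  "base_polytope G = convex hull {indicator_vec B | B. spanning_forest G B}"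

section \<open>Gorenstein polytopes\<close>

text \<open>
  \<open>homogenized_lattice P\<close> is the subgroup of $\mathbb{Z}^E \times \mathbb{Z}$ generated by the
  lattice points of \<open>P\<close> placed at height 1. Its elements at height 1 form the affine lattice
  spanned by (the lattice points of) \<open>P\<close>, and its elements at height \<open>\<delta>\<close> are the
  lattice points of the \<open>\<delta>\<close>-th dilate of that affine lattice. Measuring integrality and
  primitivity of linear forms on this group amounts to regarding \<open>P\<close> as full-dimensional.
\<close>

definition homogenized_lattice :: "(real ^ 'n) set \<Rightarrow> ((real ^ 'n) \<times> real) set" where
  "homogenized_lattice P = group_closure ({x \<in> P. \<forall>i. x $ i \<in> \<int>} \<times> {1})"

definition cone_over :: "(real ^ 'n) set \<Rightarrow> ((real ^ 'n) \<times> real) set" where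
  "cone_over P = convex_cone hull (P \<times> {1})"

text \<open>
  A form primitive on a lattice \<open>L\<close> is integral on \<open>L\<close> and not a proper integer multiple of another
  integral form; in particular it does not vanish on \<open>L\<close>.
\<close>

definition primitive_form_on :: "'a::real_vector set \<Rightarrow> ('a \<Rightarrow> real) \<Rightarrow> bool" where
  "primitive_form_on L h \<longleftrightarrow>
     linear h \<and> (\<forall>x\<in>L. h x \<in> \<int>) \<and>
     \<not> (\<exists>k::nat. k > 1 \<and> (\<forall>x\<in>L. h x / real k \<in> \<int>))"

text \<open>
  The forms live on the whole ambient space, so that a reduced equation is determined only up to
  forms vanishing on the linear span of the cone. The values on the cone and on the lattice are
  uniquely determined by the facet.
\<close>

definition reduced_equation ::
    "(real ^ 'n) set \<Rightarrow> ((real ^ 'n) \<times> real) set \<Rightarrow> ((real ^ 'n) \<times> real \<Rightarrow> real) \<Rightarrow> bool" where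
  "reduced_equation P F h \<longleftrightarrow>
     primitive_form_on (homogenized_lattice P) h \<and>
     (\<forall>x\<in>cone_over P. 0 \<le> h x) \<and>
     F = {x \<in> cone_over P. h x = 0}"

text \<open>
  The notion is intended for normal lattice polytopes \<open>P\<close> and positive \<open>\<delta>\<close>. Base polytopes of
  matroids are normal by a theorem of White, so normality is not part of the predicate.
\<close>

definition gorenstein :: "nat \<Rightarrow> (real ^ 'n) set \<Rightarrow> bool" where
  "gorenstein \<delta> P \<longleftrightarrow>
     (\<exists>v. v \<in> (\<lambda>x. real \<delta> *\<^sub>R x) ` P \<and> (v, real \<delta>) \<in> homogenized_lattice P \<and>
        (\<forall>F. F facet_of cone_over P \<longrightarrow>
           (\<exists>h. reduced_equation P F h \<and> h (v, real \<delta>) = 1)))"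

end

theory Submission
  imports Defs
begin

text \<open>
  The basic link between graphs and polytopes: a connected loopless graph with at least two
  vertices is 2-connected iff the only edge weightings giving all spanning trees the same weight
  are the constant ones. If \<open>e\<close> and \<open>f\<close> share the vertex \<open>v\<close>, then adding either of them to a
  spanning tree of the graph without \<open>v\<close> gives a spanning tree, so their weights agree; conversely
  a cut vertex splits the edges into two parts that every spanning tree meets in fixed numbers.

  A face of the cone cut out by a linear form is a facet iff every linear form vanishing on it
  is a multiple of that form on the span of the cone. By the link, $x_e \ge 0$ defines a facet when
  $G \setminus e$ is 2-connected, and $x(E(S)) \le (|S|-1)\,t$ does when \<open>S\<close> is a good flat, because
  its spanning trees are unions of spanning trees of $G|_S$ and of the contraction. Conversely, the
  spanning trees on an arbitrary facet are the maximal ones for some weighting; unless they all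
  avoid one edge, a component of the set of heaviest edges is the sought good flat. All these forms
  take the value 1 on the lattice and so are the reduced equations.
  Finally, for every edge \<open>e\<close> of a 2-connected simple graph with at least three vertices
  $G \setminus e$ or $G/e$ is 2-connected, which restricts the weights to $1$ and $\delta - 1$.
\<close>

section \<open>Spanning trees and 2-connectedness\<close>

text \<open>Every spanning tree satisfies \<open>x(E) = |V| - 1\<close>, so the base polytope is not
  full-dimensional and a facet determines its form only modulo this equation. Forms are therefore
  compared on the span of the cone only. That span is generated by the points of spanning trees,
  which turns statements about forms into statements about the sums of edge weightings over trees.
  The weight function is the lattice point \<open>v\<close> itself: the lattice contains all
  differences of unit vectors, so its points at height \<delta> are exactly the integer vectors of
  coordinate sum \<delta>(|V| - 1). Value one on all facets gives the conditions on weights.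
  Conversely, a point of the span that is positive on all facets lies in the cone, which puts
  \<open>v\<close> into \<delta>P. The graph with one edge is exceptional: deleting the edge
  disconnects it and contracting leaves one vertex, yet the cone is a ray whose apex is a facet.
  There the total weight and the two admissible values force \<delta> = 1.\<close>

definition reach :: "('e \<Rightarrow> 'v set) \<Rightarrow> 'e set \<Rightarrow> 'v \<Rightarrow> 'v \<Rightarrow> bool" where
  "reach en F = (\<lambda>u v. \<exists>e\<in>F. en e = {u, v})\<^sup>*\<^sup>*"

definition connects :: "('e \<Rightarrow> 'v set) \<Rightarrow> 'v set \<Rightarrow> 'e set \<Rightarrow> bool" where
  "connects en V F \<longleftrightarrow> (\<forall>u\<in>V. \<forall>v\<in>V. reach en F u v)"

text \<open>Trees are encoded by connectivity and an edge count instead of acyclicity: the count is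
  additive when a vertex set is contracted, which is what splitting and gluing trees needs.\<close>

definition spanning_tree :: "('v, 'e) multigraph \<Rightarrow> 'e set \<Rightarrow> bool" where
  "spanning_tree H B \<longleftrightarrow>
     B \<subseteq> edges H \<and> connects (ends H) (verts H) B \<and> card B + 1 = card (verts H)"

text \<open>Parallel edges stay allowed because contracting \<open>E(S)\<close> creates them even in
  a simple graph. Loops do not arise there, since an edge with both ends in \<open>S\<close> is
  itself contracted.\<close>

definition loopless :: "('v, 'e) multigraph \<Rightarrow> bool" where
  "loopless H \<longleftrightarrow>
     finite (verts H) \<and> (\<forall>e\<in>edges H. ends H e \<subseteq> verts H \<and> card (ends H e) = 2)"

lemma reach_refl [simp]: "reach en F u u"
  by (simp add: reach_def)

lemma reach_trans [trans]: "reach en F u v \<Longrightarrow> reach en F v w \<Longrightarrow> reach en F u w"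
  by (simp add: reach_def)

lemma reach_edge: "e \<in> F \<Longrightarrow> en e = {u, v} \<Longrightarrow> reach en F u v"
  unfolding reach_def by (rule r_into_rtranclp) blast

lemma reach_sym: "reach en F u v \<Longrightarrow> reach en F v u"
proof -
  assume "reach en F u v"
  moreover have "symp (\<lambda>u v. \<exists>e\<in>F. en e = {u, v})"
    by (auto simp: symp_def insert_commute)
  ultimately show ?thesis
    unfolding reach_def by (blast dest: symp_rtranclp sympD)
qed

lemma reach_induct [consumes 1, case_names refl step]:
  assumes "reach en F u v" and "P u"
    and "\<And>x y e. reach en F u x \<Longrightarrow> P x \<Longrightarrow> e \<in> F \<Longrightarrow> en e = {x, y} \<Longrightarrow> P y"
  shows "P v"
  using assms(1) unfolding reach_def
proof (induction rule: rtranclp_induct)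
  case base
  then show ?case by fact
next
  case (step y z)
  then show ?case using assms(3)[folded reach_def] unfolding reach_def[symmetric] by blast
qed

text \<open>Walks are transported along a vertex map \<open>p\<close>. Besides the identity,
  \<open>p\<close> will be a collapse of a vertex set to one vertex, the projection to a
  contraction, or a choice of representatives for lifting back.\<close>

lemma reach_hom:
  assumes "reach en F u v"
    and "\<And>e x y. e \<in> F \<Longrightarrow> en e = {x, y} \<Longrightarrow> reach en' F' (p x) (p y)"
  shows "reach en' F' (p u) (p v)"
  using assms(1) by (induction rule: reach_induct) (auto intro: reach_trans assms(2))

lemma reach_mono: "reach en F u v \<Longrightarrow> F \<subseteq> F' \<Longrightarrow> reach en F' u v"
  using reach_hom[of en F u v en F' "\<lambda>x. x"] by (auto intro: reach_edge)

lemma reach_leaves: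
  assumes "reach en F u v" and "u \<in> U" and "v \<notin> U"
  obtains e x y where "e \<in> F" "en e = {x, y}" "x \<in> U" "y \<notin> U"
proof -
  have "v \<in> U \<or> (\<exists>e\<in>F. \<exists>x y. en e = {x, y} \<and> x \<in> U \<and> y \<notin> U)"
    using assms(1) by (induction rule: reach_induct) (use assms(2) in auto)
  then obtain e x y where "e \<in> F" "en e = {x, y}" "x \<in> U" "y \<notin> U" using assms(3) by blast
  then show thesis by (rule that)
qed

lemma reach_insert:
  assumes "reach en (insert f F) u v" and "\<not> reach en F u v" and "en f = {p, q}"
  shows "reach en F u p \<and> reach en F q v \<or> reach en F u q \<and> reach en F p v"
proof -
  have "reach en F u v \<or> reach en F u p \<and> reach en F q v \<or> reach en F u q \<and> reach en F p v"
    using assms(1)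
  proof (induction rule: reach_induct)
    case refl
    then show ?case by simp
  next
    case (step x y e)
    show ?case
    proof (cases "e = f")
      case True
      then have "x = p \<and> y = q \<or> x = q \<and> y = p"
        using step assms(3) by (auto simp: doubleton_eq_iff)
      then show ?thesis using step.IH by auto
    next
      case False
      then have "reach en F x y" using step by (auto intro: reach_edge)
      then show ?thesis using step.IH by (meson reach_trans)
    qed
  qed
  then show ?thesis using assms(2) by blast
qed

lemma connectsI:
  assumes "\<And>u. u \<in> V \<Longrightarrow> reach en F u a"
  shows "connects en V F"
  unfolding connects_def by (meson assms reach_sym reach_trans)

lemma connects_mono: "connects en V F \<Longrightarrow> F \<subseteq> F' \<Longrightarrow> connects en V F'"
  unfolding connects_def using reach_mono by metis

lemma connects_subst:
  assumes "connects en V F" and "\<And>e x y. e \<in> F \<Longrightarrow> en e = {x, y} \<Longrightarrow> reach en F' x y"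
  shows "connects en V F'"
  unfolding connects_def
proof (intro ballI)
  fix u v assume "u \<in> V" "v \<in> V"
  then have "reach en F u v" using assms(1) by (simp add: connects_def)
  from reach_hom[OF this, where p = "\<lambda>x. x"] show "reach en F' u v" using assms(2) by blast
qed

text \<open>Prim's procedure: a tree \<open>B\<close> on \<open>U\<close> grows by one vertex as
  long as \<open>U\<close> is not all of \<open>V\<close>, because a walk from \<open>U\<close> to a
  missing vertex uses an edge of \<open>F\<close> leaving \<open>U\<close>.\<close>

lemma connects_imp_tree:
  fixes F :: "'e::finite set"
  assumes "connects en V F" and "finite V" and "V \<noteq> {}"
    and F: "\<And>e. e \<in> F \<Longrightarrow> en e \<subseteq> V"
  shows "\<exists>B\<subseteq>F. connects en V B \<and> card B + 1 = card V"
proof -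
  define tr where "tr U B \<longleftrightarrow> U \<subseteq> V \<and> B \<subseteq> F \<and> connects en U B \<and> card B + 1 = card U \<and>
    (\<forall>e\<in>B. en e \<subseteq> U)" for U B
  have grow: "\<exists>U B. tr U B \<and> card U = Suc n" if "Suc n \<le> card V" for n
    using that
  proof (induction n)
    case 0
    obtain a where "a \<in> V" using assms(3) by blast
    then have "tr {a} {}" by (auto simp: tr_def connects_def)
    then show ?case by force
  next
    case (Suc n)
    then obtain U B where UB: "tr U B" "card U = Suc n" by auto
    then have "U \<noteq> V" "U \<subseteq> V" "U \<noteq> {}" using Suc.prems by (auto simp: tr_def)
    then obtain u v where uv: "u \<in> U" "v \<in> V" "v \<notin> U" by blast
    then have "reach en F u v" using assms(1) \<open>U \<subseteq> V\<close> by (auto simp: connects_def)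
    then obtain e x y where e: "e \<in> F" "en e = {x, y}" "x \<in> U" "y \<notin> U"
      by (rule reach_leaves) (use uv in auto)
    have "y \<in> V" using F[OF e(1)] e(2) by auto
    have "e \<notin> B" using UB(1) e by (auto simp: tr_def)
    have fU: "finite U" using UB(2) card.infinite by fastforce
    have "connects en (insert y U) (insert e B)"
    proof (rule connectsI[where a = x])
      fix u assume "u \<in> insert y U"
      then show "reach en (insert e B) u x"
      proof
        assume "u = y"
        then show ?thesis using reach_edge[of e "insert e B" en y x] e(2)
          by (simp add: insert_commute)
      next
        assume "u \<in> U"
        then have "reach en B u x" using UB(1) e(3) by (simp add: tr_def connects_def)
        then show ?thesis by (rule reach_mono) blast
      qed
    qed
    then have "tr (insert y U) (insert e B)"
      using UB \<open>y \<in> V\<close> \<open>e \<notin> B\<close> e fU unfolding tr_def by auto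
    moreover have "card (insert y U) = Suc (Suc n)" using UB(2) e(4) fU by simp
    ultimately show ?case by blast
  qed
  have "card V > 0" using assms by (simp add: card_gt_0_iff)
  then have "\<exists>U B. tr U B \<and> card U = card V" using grow[of "card V - 1"] by simp
  then obtain U B where "tr U B" "card U = card V" by blast
  moreover from this have "U = V" using assms(2) card_subset_eq by (metis tr_def)
  ultimately show ?thesis by (auto simp: tr_def)
qed

text \<open>The tree inside \<open>F\<close> already needs \<open>|V| - 1\<close> edges. This bound
  takes over the role of acyclicity: contradictions come from sets that would connect with too few
  edges.\<close>

lemma connects_card:
  fixes F :: "'e::finite set"
  assumes "connects en V F" and "finite V" and "\<And>e. e \<in> F \<Longrightarrow> en e \<subseteq> V"
  shows "card V \<le> card F + 1"
proof (cases "V = {}")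
  case False
  then obtain B where "B \<subseteq> F" "card B + 1 = card V"
    using connects_imp_tree[OF assms(1,2)] assms(3) by blast
  moreover from this have "card B \<le> card F" by (simp add: card_mono)
  ultimately show ?thesis by simp
qed simp

lemma loopless_ends:
  assumes "loopless H" and "e \<in> edges H"
  obtains u v where "ends H e = {u, v}" "u \<noteq> v" "u \<in> verts H" "v \<in> verts H"
proof -
  have "ends H e \<subseteq> verts H" "card (ends H e) = 2" using assms by (auto simp: loopless_def)
  then show thesis using that by (auto simp: card_2_iff)
qed

lemma spanning_tree_exists:
  fixes H :: "('v, 'e::finite) multigraph"
  assumes "loopless H" and "F \<subseteq> edges H" and "connects (ends H) (verts H) F" and "verts H \<noteq> {}"
  obtains B where "B \<subseteq> F" "spanning_tree H B"
proof -
  have "\<exists>B\<subseteq>F. connects (ends H) (verts H) B \<and> card B + 1 = card (verts H)"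
    using assms by (intro connects_imp_tree) (auto simp: loopless_def)
  then show thesis using that assms(2) unfolding spanning_tree_def by blast
qed

lemma spanning_tree_bridge:
  fixes H :: "('v, 'e::finite) multigraph"
  assumes "loopless H" and "spanning_tree H B" and "f \<in> B" and "ends H f = {p, q}"
  shows "\<not> reach (ends H) (B - {f}) p q"
proof
  assume pq: "reach (ends H) (B - {f}) p q"
  have "connects (ends H) (verts H) (B - {f})"
  proof (rule connects_subst)
    show "connects (ends H) (verts H) B" using assms(2) by (simp add: spanning_tree_def)
    fix e x y assume e: "e \<in> B" "ends H e = {x, y}"
    show "reach (ends H) (B - {f}) x y"
    proof (cases "e = f")
      case True
      then show ?thesis using e(2) assms(4) pq reach_sym[OF pq] by (auto simp: doubleton_eq_iff)
    next
      case False
      then show ?thesis using e by (auto intro: reach_edge)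
    qed
  qed
  then have "card (verts H) \<le> card (B - {f}) + 1"
    using assms by (intro connects_card) (auto simp: loopless_def spanning_tree_def)
  moreover have "card (B - {f}) + 1 = card B" using card_Suc_Diff1[OF _ assms(3)] by simp
  ultimately show False using assms(2) by (simp add: spanning_tree_def)
qed

text \<open>\<open>X\<close> collects tree edges that must survive. Among the sets between
  \<open>X\<close> and \<open>B\<close> that do not join \<open>u\<close> and \<open>v\<close>, a
  maximal one \<open>Y\<close> misses some \<open>f\<close> of \<open>B\<close>. Adding
  \<open>f\<close> to \<open>Y\<close> joins \<open>u\<close> and \<open>v\<close>, so the ends of
  \<open>f\<close> remain linked through \<open>Y\<close> and \<open>e\<close> once \<open>f\<close>
  is removed.\<close>

lemma spanning_tree_exchange:
  fixes H :: "('v, 'e::finite) multigraph"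
  assumes "spanning_tree H B" and "e \<in> edges H" and "e \<notin> B" and "X \<subseteq> B"
    and uv: "ends H e = {u, v}" "u \<in> verts H" "v \<in> verts H" and "\<not> reach (ends H) X u v"
  obtains f where "f \<in> B" "f \<notin> X" "spanning_tree H (insert e (B - {f}))"
proof -
  let ?P = "\<lambda>Y. X \<subseteq> Y \<and> Y \<subseteq> B \<and> \<not> reach (ends H) Y u v"
  have "finite {Y. ?P Y}" "{Y. ?P Y} \<noteq> {}" using assms by auto
  then obtain Y where "Y \<in> {Y. ?P Y}" and max': "\<forall>Z\<in>{Y. ?P Y}. Y \<subseteq> Z \<longrightarrow> Y = Z"
    by (meson finite_has_maximal)
  then have Y: "?P Y" by simp
  have max: "Z = Y" if "?P Z" "Y \<subseteq> Z" for Z using max' that by blast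
  have "reach (ends H) B u v" using assms by (simp add: spanning_tree_def connects_def)
  then have "Y \<noteq> B" using Y by auto
  then obtain f where f: "f \<in> B" "f \<notin> Y" using Y by blast
  have Yf: "reach (ends H) (insert f Y) u v"
    using max[of "insert f Y"] Y f by blast
  let ?B = "insert e (B - {f})"
  have sub: "Y \<subseteq> ?B" using Y f by blast
  have "reach (ends H) ?B u v" using reach_edge[of e ?B "ends H" u v] uv by simp
  have "connects (ends H) (verts H) ?B"
  proof (rule connects_subst)
    show "connects (ends H) (verts H) B" using assms(1) by (simp add: spanning_tree_def)
    fix g x y assume g: "g \<in> B" "ends H g = {x, y}"
    show "reach (ends H) ?B x y"
    proof (cases "g = f")
      case True
      then have "reach (ends H) Y u x \<and> reach (ends H) Y y v \<or> reach (ends H) Y u y \<and> reach (ends H) Y x v"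
        using reach_insert[OF Yf _ ] Y g(2) by blast
      then show ?thesis
        using reach_mono[OF _ sub] \<open>reach (ends H) ?B u v\<close> by (meson reach_sym reach_trans)
    next
      case False
      then show ?thesis using g by (auto intro: reach_edge)
    qed
  qed
  moreover have "card ?B = card B" using f(1) assms(3) card_Suc_Diff1[of B f] by simp
  ultimately have "spanning_tree H ?B" using assms unfolding spanning_tree_def by auto
  moreover have "f \<notin> X" using Y f by blast
  ultimately show thesis using that f by blast
qed

lemma connected_graph_iff:
  "connected_graph H \<longleftrightarrow> verts H \<noteq> {} \<and> connects (ends H) (verts H) (edges H)"
  unfolding connected_graph_def connects_def reach_def adjacent_def by (rule refl)

lemma two_connected_delete_vertex:
  "two_connected H \<Longrightarrow> v \<in> verts H \<Longrightarrow> connected_graph (delete_vertex H v)"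
  unfolding two_connected_def cut_vertex_def by blast

lemma loopless_delete_vertex: "loopless H \<Longrightarrow> loopless (delete_vertex H v)"
  by (auto simp: loopless_def delete_vertex_def)

lemma two_connected_exchange:
  fixes H :: "('v, 'e::finite) multigraph"
  assumes "loopless H" and "two_connected H" and "v \<in> verts H"
  obtains B where "\<And>e. e \<in> edges H \<Longrightarrow> v \<in> ends H e \<Longrightarrow> e \<notin> B \<and> spanning_tree H (insert e B)"
proof -
  let ?D = "delete_vertex H v"
  have "connected_graph ?D" using assms by (simp add: two_connected_delete_vertex)
  then obtain B where B: "spanning_tree ?D B"
    using spanning_tree_exists[OF loopless_delete_vertex[OF assms(1)] subset_refl]
    unfolding connected_graph_iff by metis
  have "e \<notin> B \<and> spanning_tree H (insert e B)" if e: "e \<in> edges H" "v \<in> ends H e" for e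
  proof -
    have "e \<notin> B" using B e by (auto simp: spanning_tree_def delete_vertex_def)
    obtain a b where ab: "ends H e = {a, b}" "a \<noteq> b" "a \<in> verts H" "b \<in> verts H"
      using loopless_ends[OF assms(1) e(1)] by metis
    define x where "x = (if v = a then b else a)"
    have x: "ends H e = {v, x}" "x \<noteq> v" "x \<in> verts H" using ab e(2) by (auto simp: x_def)
    have "connects (ends H) (verts H) (insert e B)"
    proof (rule connectsI[where a = x])
      fix u assume "u \<in> verts H"
      show "reach (ends H) (insert e B) u x"
      proof (cases "u = v")
        case True
        then show ?thesis using x reach_edge[of e "insert e B" "ends H" v x] by simp
      next
        case False
        then have "reach (ends H) B u x" using \<open>u \<in> verts H\<close> x B
          by (simp add: spanning_tree_def connects_def delete_vertex_def)
        then show ?thesis by (rule reach_mono) blast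
      qed
    qed
    moreover have "card (insert e B) + 1 = card (verts H)"
      using B \<open>e \<notin> B\<close> assms(1,3) card_Suc_Diff1[of "verts H" v]
      by (simp add: spanning_tree_def delete_vertex_def loopless_def)
    moreover have "insert e B \<subseteq> edges H"
      using B e by (auto simp: spanning_tree_def delete_vertex_def)
    ultimately show ?thesis using \<open>e \<notin> B\<close> by (simp add: spanning_tree_def)
  qed
  then show thesis using that by blast
qed

text \<open>Edges at a common vertex are related by exchanging them, and connectivity carries this
  along walks. \<open>R\<close> is left abstract because it is used both as equality of weights and
  as membership of a difference of unit vectors in the lattice.\<close>

lemma two_connected_edges_related:
  fixes H :: "('v, 'e::finite) multigraph"
  assumes "loopless H" and "two_connected H"
    and trans: "\<And>e f g. R e f \<Longrightarrow> R f g \<Longrightarrow> R e g"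
    and step: "\<And>e f B. e \<notin> B \<Longrightarrow> f \<notin> B \<Longrightarrow> spanning_tree H (insert e B) \<Longrightarrow>
      spanning_tree H (insert f B) \<Longrightarrow> R e f"
    and "e \<in> edges H" and "f \<in> edges H"
  shows "R e f"
proof -
  have star: "R e f" if "e \<in> edges H" "f \<in> edges H" "v \<in> ends H e" "v \<in> ends H f" for e f v
  proof -
    have "v \<in> verts H" using assms(1) that by (auto simp: loopless_def)
    then obtain B where "\<And>e. e \<in> edges H \<Longrightarrow> v \<in> ends H e \<Longrightarrow> e \<notin> B \<and> spanning_tree H (insert e B)"
      using two_connected_exchange[OF assms(1,2)] by metis
    then show ?thesis using step[of e B f] that by blast
  qed
  obtain u v where uv: "u \<in> ends H e" "v \<in> ends H f" "u \<in> verts H" "v \<in> verts H"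
    using loopless_ends[OF assms(1)] assms(5,6) by (metis insertI1)
  then have "reach (ends H) (edges H) u v"
    using assms(2) by (auto simp: two_connected_def connected_graph_iff connects_def)
  then have "\<forall>f\<in>edges H. v \<in> ends H f \<longrightarrow> R e f"
  proof (induction rule: reach_induct)
    case refl
    then show ?case using star uv assms(5) by blast
  next
    case (step x y g)
    then have "R e g" by auto
    have "R g f" if "f \<in> edges H" "y \<in> ends H f" for f
      using star[of g f y] step that by auto
    then show ?case using trans \<open>R e g\<close> by blast
  qed
  then show ?thesis using uv assms(6) by blast
qed

lemma two_connected_rigid:
  fixes H :: "('v, 'e::finite) multigraph" and c :: "'e \<Rightarrow> real"
  assumes "loopless H" and "two_connected H"
    and "\<And>B. spanning_tree H B \<Longrightarrow> sum c B = k"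
    and "e \<in> edges H" and "f \<in> edges H"
  shows "c e = c f"
  using assms(1,2)
proof (rule two_connected_edges_related[where R = "\<lambda>e f. c e = c f"])
  fix e f B assume "e \<notin> B" "f \<notin> B" "spanning_tree H (insert e B)" "spanning_tree H (insert f B)"
  then have "sum c (insert e B) = k" "sum c (insert f B) = k" by (simp_all only: assms(3))
  then show "c e = c f" using \<open>e \<notin> B\<close> \<open>f \<notin> B\<close> by (simp add: algebra_simps)
qed (use assms in auto)

text \<open>Each side of a cut vertex needs a minimum number of edges to be connected through that
  vertex, and the two minima add up to the size of a spanning tree. So both are attained by every
  tree, and the indicator of one side is the weighting sought.\<close>

lemma not_two_connected_flexible:
  fixes H :: "('v, 'e::finite) multigraph"
  assumes "loopless H" and "connected_graph H" and "2 \<le> card (verts H)" and "\<not> two_connected H"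
  obtains c :: "'e \<Rightarrow> real" and e f k where "e \<in> edges H" "f \<in> edges H" "c e \<noteq> c f"
    "\<And>B. spanning_tree H B \<Longrightarrow> sum c B = k"
proof -
  have "\<exists>v. cut_vertex H v" using assms(2-4) unfolding two_connected_def by blast
  then obtain v where v: "v \<in> verts H" "\<not> connected_graph (delete_vertex H v)"
    unfolding cut_vertex_def by blast
  have fin: "finite (verts H)" using assms(1) by (simp add: loopless_def)
  let ?E = "{e \<in> edges H. v \<notin> ends H e}"
  have "verts H - {v} \<noteq> {}"
  proof
    assume "verts H - {v} = {}"
    then have "verts H \<subseteq> {v}" by blast
    then have "card (verts H) \<le> card {v}" by (intro card_mono) auto
    then show False using assms(3) by simp
  qed
  then obtain u w where uw: "u \<in> verts H - {v}" "w \<in> verts H - {v}" "\<not> reach (ends H) ?E u w"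
    using v(2) by (auto simp: connected_graph_iff delete_vertex_def connects_def)
  \<comment> \<open>\<open>U\<close> is the component of \<open>u\<close> once the cut vertex
    \<open>v\<close> is removed; an edge meeting it has its other end in \<open>U\<close> or at
    \<open>v\<close>.\<close>
  define U where "U = {x \<in> verts H - {v}. reach (ends H) ?E u x}"
  define D where "D = {e \<in> edges H. ends H e \<inter> U \<noteq> {}}"
  have U: "u \<in> U" "U \<subseteq> verts H - {v}" "w \<notin> U" "v \<notin> U" "finite U" using uw fin by (auto simp: U_def)
  have closed: "y \<in> insert v U" if "e \<in> D" "ends H e = {x, y}" for e x y
  proof (rule ccontr)
    assume y: "y \<notin> insert v U"
    then have "x \<in> U" "x \<noteq> v" using that U by (auto simp: D_def)
    then have "e \<in> ?E" using that y by (auto simp: D_def)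
    then have "reach (ends H) ?E u y"
      using \<open>x \<in> U\<close> that(2) reach_edge[of e ?E "ends H" x y] unfolding U_def by (blast intro: reach_trans)
    moreover have "y \<in> verts H" using \<open>e \<in> ?E\<close> that(2) assms(1) by (auto simp: loopless_def)
    ultimately show False using y by (simp add: U_def)
  qed
  have DU: "ends H e \<subseteq> insert v U" if "e \<in> D" for e
  proof -
    have "e \<in> edges H" using that by (simp add: D_def)
    then obtain x y where xy: "ends H e = {x, y}" using loopless_ends[OF assms(1)] by metis
    moreover have "ends H e = {y, x}" using xy by auto
    ultimately show ?thesis using closed[OF that] by auto
  qed
  \<comment> \<open>Stated for all connecting sets and not just for trees: applied to the whole edge
    set, the bounds also show that neither \<open>D\<close> nor its complement is empty.\<close>
  have split: "card U \<le> card (B \<inter> D) \<and> card (verts H) \<le> card (B - D) + card U + 1"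
    if B: "B \<subseteq> edges H" "connects (ends H) (verts H) B" for B
  proof -
    have "connects (ends H) (insert v U) (B \<inter> D)"
    proof (rule connectsI[where a = v])
      fix x assume "x \<in> insert v U"
      \<comment> \<open>Collapsing everything outside \<open>U\<close> to \<open>v\<close> makes the
        edges outside \<open>D\<close> stationary, so a walk in \<open>B\<close> becomes one in
        \<open>B \<inter> D\<close>.\<close>
      define p where "p x = (if x \<in> U then x else v)" for x
      have "reach (ends H) B x v" using \<open>x \<in> insert v U\<close> U v(1) B by (auto simp: connects_def)
      then have "reach (ends H) (B \<inter> D) (p x) (p v)"
      proof (rule reach_hom)
        fix e x y assume e: "e \<in> B" "ends H e = {x, y}"
        show "reach (ends H) (B \<inter> D) (p x) (p y)"
        proof (cases "e \<in> D")
          case True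
          then have "{x, y} \<subseteq> insert v U" using DU e by metis
          then have "p x = x" "p y = y" by (auto simp: p_def)
          then show ?thesis using reach_edge[of e "B \<inter> D" "ends H" x y] e True by simp
        next
          case False
          then have "x \<notin> U" "y \<notin> U" using e B by (auto simp: D_def)
          then show ?thesis by (simp add: p_def)
        qed
      qed
      then show "reach (ends H) (B \<inter> D) x v"
        using \<open>x \<in> insert v U\<close> U by (auto simp: p_def split: if_splits)
    qed
    then have "card (insert v U) \<le> card (B \<inter> D) + 1"
      using DU U by (intro connects_card) auto
    moreover have "card (insert v U) = card U + 1" using U by simp
    moreover have "connects (ends H) (verts H - U) (B - D)"
    proof (rule connectsI[where a = v])
      fix x assume x: "x \<in> verts H - U"
      define p where "p x = (if x \<in> U then v else x)" for x
      have "reach (ends H) B x v" using x v(1) B by (auto simp: connects_def)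
      then have "reach (ends H) (B - D) (p x) (p v)"
      proof (rule reach_hom)
        fix e x y assume e: "e \<in> B" "ends H e = {x, y}"
        show "reach (ends H) (B - D) (p x) (p y)"
        proof (cases "e \<in> D")
          case True
          then have "{x, y} \<subseteq> insert v U" using DU e by metis
          then have "p x = v" "p y = v" by (auto simp: p_def)
          then show ?thesis by simp
        next
          case False
          then have "x \<notin> U" "y \<notin> U" using e B by (auto simp: D_def)
          then show ?thesis using e False by (auto simp: p_def intro: reach_edge)
        qed
      qed
      then show "reach (ends H) (B - D) x v" using x U by (auto simp: p_def)
    qed
    then have "card (verts H - U) \<le> card (B - D) + 1"
      using fin assms(1) B by (intro connects_card) (auto simp: loopless_def D_def)
    moreover have "card (verts H - U) + card U = card (verts H)"
    proof -
      have "U \<subseteq> verts H" using U by blast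
      then show ?thesis using card_mono[OF fin] \<open>finite U\<close> by (simp add: card_Diff_subset)
    qed
    ultimately show ?thesis by simp
  qed
  have E: "connects (ends H) (verts H) (edges H)" using assms(2) by (simp add: connected_graph_iff)
  have "card U > 0" using U card_gt_0_iff by blast
  then have "card (edges H \<inter> D) > 0" using split[OF subset_refl E] by linarith
  then have "edges H \<inter> D \<noteq> {}" by force
  then obtain e where e: "e \<in> edges H" "e \<in> D" by blast
  have "card (insert w (insert v U)) \<le> card (verts H)" using U uw v fin by (intro card_mono) auto
  moreover have "card (insert w (insert v U)) = card U + 2" using U uw by simp
  ultimately have "card (edges H - D) > 0" using split[OF subset_refl E] by linarith
  then have "edges H - D \<noteq> {}" by force
  then obtain f where f: "f \<in> edges H" "f \<notin> D" by blast
  have "sum (\<lambda>e. if e \<in> D then 1 else 0 :: real) B = card U" if "spanning_tree H B" for B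
  proof -
    have "card (B \<inter> D) + card (B - D) = card B"
      using card_Un_disjoint[of "B \<inter> D" "B - D"] by (simp add: Int_Diff_Un Int_Diff_disjoint)
    then have "card (B \<inter> D) = card U" using split[of B] that by (auto simp: spanning_tree_def)
    moreover have "sum (\<lambda>e. if e \<in> D then 1 else 0 :: real) B = card (B \<inter> D)"
      by (simp add: sum.If_cases)
    ultimately show ?thesis by simp
  qed
  then show thesis using that[of e f "\<lambda>e. if e \<in> D then 1 else 0"] e f by simp
qed

section \<open>Forests and contractions\<close>

lemma simple_graph_loopless: "simple_graph G \<Longrightarrow> loopless G"
  by (simp add: simple_graph_def loopless_def)

section \<open>Cycles, paths and bases of the graphic matroid\<close>

lemma cycle_reach:
  assumes "is_cycle H vs es" and "e \<in> set es" and "ends H e = {p, q}"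
  shows "reach (ends H) (set es - {e}) p q"
proof -
  let ?n = "length vs"
  obtain i where i: "i < ?n" "e = es ! i"
    using assms(1,2) by (auto simp: is_cycle_def in_set_conv_nth)
  have ends: "ends H (es ! k) = {vs ! k, vs ! (Suc k mod ?n)}" if "k < ?n" for k
    using assms(1) that by (simp add: is_cycle_def)
  have walk: "reach (ends H) (set es - {e}) (vs ! (Suc i mod ?n)) (vs ! ((Suc i + j) mod ?n))"
    if "j < ?n" for j
    using that
  proof (induction j)
    case 0
    then show ?case by simp
  next
    case (Suc j)
    define m where "m = (Suc i + j) mod ?n"
    have "0 < ?n" using i(1) by linarith
    then have "m < ?n" unfolding m_def by (rule mod_less_divisor)
    have "m \<noteq> i"
    proof (cases "Suc i + j < ?n")
      case False
      then have "m = Suc i + j - ?n"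
        using i(1) Suc.prems unfolding m_def by (subst mod_if) (simp add: mod_if)
      then show ?thesis using Suc.prems False i(1) by linarith
    qed (simp add: m_def)
    then have "es ! m \<noteq> e"
      using i \<open>m < ?n\<close> assms(1) by (simp add: is_cycle_def nth_eq_iff_index_eq)
    then have "es ! m \<in> set es - {e}" using \<open>m < ?n\<close> assms(1) by (simp add: is_cycle_def)
    moreover have "Suc m mod ?n = (Suc i + Suc j) mod ?n" by (simp add: m_def mod_Suc_eq)
    ultimately have "reach (ends H) (set es - {e}) (vs ! m) (vs ! ((Suc i + Suc j) mod ?n))"
      using ends[OF \<open>m < ?n\<close>] by (simp add: reach_edge)
    then show ?case using Suc reach_trans unfolding m_def by (metis Suc_lessD)
  qed
  have "Suc i + (?n - 1) = i + ?n" using i(1) by linarith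
  then have "(Suc i + (?n - 1)) mod ?n = i" using i(1) by simp
  then have "reach (ends H) (set es - {e}) (vs ! (Suc i mod ?n)) (vs ! i)"
    using walk[of "?n - 1"] i(1) by auto
  then show ?thesis
    using ends[OF i(1)] i(2) assms(3) by (auto simp: doubleton_eq_iff intro: reach_sym)
qed

text \<open>Cycles require distinct vertices, so the walk is shortened while it is built: when the
  next vertex already occurs, the path is cut back to it.\<close>

lemma reach_path:
  assumes "loopless H" and "F \<subseteq> edges H" and "reach (ends H) F p q" and "p \<in> verts H"
  obtains vs es where "vs \<noteq> []" "hd vs = p" "last vs = q" "distinct vs" "set vs \<subseteq> verts H"
    "length vs = Suc (length es)" "set es \<subseteq> F"
    "\<And>i. i < length es \<Longrightarrow> ends H (es ! i) = {vs ! i, vs ! Suc i}"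
proof -
  have "\<exists>vs es. vs \<noteq> [] \<and> hd vs = p \<and> last vs = q \<and> distinct vs \<and> set vs \<subseteq> verts H \<and>
    length vs = Suc (length es) \<and> set es \<subseteq> F \<and>
    (\<forall>i<length es. ends H (es ! i) = {vs ! i, vs ! Suc i})"
    using assms(3)
  proof (induction rule: reach_induct)
    case refl
    show ?case using assms(4) by (intro exI[of _ "[p]"] exI[of _ "[]"]) simp
  next
    case (step x y e)
    then obtain vs es where P: "vs \<noteq> []" "hd vs = p" "last vs = x" "distinct vs"
      "set vs \<subseteq> verts H" "length vs = Suc (length es)" "set es \<subseteq> F"
      "\<forall>i<length es. ends H (es ! i) = {vs ! i, vs ! Suc i}" by blast
    show ?case
    proof (cases "y \<in> set vs")
      case True
      then obtain k where k: "k < length vs" "vs ! k = y" by (auto simp: in_set_conv_nth)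
      have "last (take (Suc k) vs) = y" using k by (simp add: take_Suc_conv_app_nth)
      moreover have "hd (take (Suc k) vs) = p" using P by (simp add: hd_take)
      moreover have "set (take (Suc k) vs) \<subseteq> verts H" "set (take k es) \<subseteq> F"
        using P set_take_subset by (metis subset_trans)+
      moreover have "\<forall>i<length (take k es). ends H (take k es ! i) =
          {take (Suc k) vs ! i, take (Suc k) vs ! Suc i}"
        using P by simp
      ultimately show ?thesis using P k
        by (intro exI[of _ "take (Suc k) vs"] exI[of _ "take k es"]) simp
    next
      case False
      have "y \<in> verts H" using step assms(1,2) by (auto simp: loopless_def)
      moreover have "ends H ((es @ [e]) ! i) = {(vs @ [y]) ! i, (vs @ [y]) ! Suc i}"
        if "i < length (es @ [e])" for i
      proof (cases "i < length es")
        case True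
        then show ?thesis using P by (simp add: nth_append)
      next
        case False
        then have "i = length es" using that by simp
        moreover have "vs ! length es = x" using P by (metis diff_Suc_1 last_conv_nth)
        ultimately show ?thesis using P(6) step by (simp add: nth_append)
      qed
      ultimately show ?thesis using P False step
        by (intro exI[of _ "vs @ [y]"] exI[of _ "es @ [e]"]) auto
    qed
  qed
  then show thesis using that by blast
qed

lemma reach_cycle:
  assumes "loopless H" and "F \<subseteq> edges H" and "e \<in> edges H" and "e \<notin> F"
    and "ends H e = {p, q}" and "reach (ends H) F p q"
  obtains vs es where "is_cycle H vs es" "set es \<subseteq> insert e F"
proof -
  have "p \<in> verts H" using assms(1,3,5) by (auto simp: loopless_def)
  then obtain vs es where P: "vs \<noteq> []" "hd vs = p" "last vs = q" "distinct vs" "set vs \<subseteq> verts H"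
    "length vs = Suc (length es)" "set es \<subseteq> F"
    "\<And>i. i < length es \<Longrightarrow> ends H (es ! i) = {vs ! i, vs ! Suc i}"
    using reach_path[OF assms(1,2,6)] by metis
  have "distinct es"
    unfolding distinct_conv_nth
  proof (intro allI impI notI)
    fix i j assume ij: "i < length es" "j < length es" "i \<noteq> j" "es ! i = es ! j"
    then have "{vs ! i, vs ! Suc i} = {vs ! j, vs ! Suc j}" using P(8) by metis
    then have "i = j" using P(4,6) ij by (auto simp: doubleton_eq_iff nth_eq_iff_index_eq)
    then show False using ij(3) by simp
  qed
  moreover have "ends H ((es @ [e]) ! i) = {vs ! i, vs ! (Suc i mod length vs)}"
    if "i < length vs" for i
  proof (cases "i < length es")
    case True
    then show ?thesis using P by (simp add: nth_append)
  next
    case False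
    then have i: "i = length es" using that P(6) by simp
    have "vs ! length es = q" "vs ! 0 = p" using P by (metis diff_Suc_1 last_conv_nth, metis hd_conv_nth)
    then show ?thesis using i P(6) assms(5) by (simp add: insert_commute)
  qed
  ultimately have "is_cycle H vs (es @ [e])"
    unfolding is_cycle_def using P assms(2-4) by auto
  then show thesis using that[of vs "es @ [e]"] P(7) by auto
qed

text \<open>A maximal forest connects the graph, since an edge between two of its components could
  be added; and an edge beyond a tree contained in it would close a cycle. From here on bases are
  handled by connectivity and counting alone.\<close>

lemma spanning_forest_iff:
  fixes G :: "('v, 'e::finite) multigraph"
  assumes "loopless G" and "connected_graph G"
  shows "spanning_forest G B \<longleftrightarrow> spanning_tree G B"
proof
  assume B: "spanning_forest G B"
  then have sub: "B \<subseteq> edges G" and nocyc: "\<And>vs es. is_cycle G vs es \<Longrightarrow> \<not> set es \<subseteq> B"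
    by (auto simp: spanning_forest_def forest_def)
  have G: "connects (ends G) (verts G) (edges G)" "verts G \<noteq> {}"
    using assms(2) by (auto simp: connected_graph_iff)
  have conn: "connects (ends G) (verts G) B"
  proof (rule connects_subst[OF G(1)])
    fix e x y assume e: "e \<in> edges G" "ends G e = {x, y}"
    show "reach (ends G) B x y"
    proof (rule ccontr)
      assume n: "\<not> reach (ends G) B x y"
      have "forest G (insert e B)"
        unfolding forest_def
      proof (intro conjI notI)
        show "insert e B \<subseteq> edges G" using e sub by blast
        assume "\<exists>vs es. is_cycle G vs es \<and> set es \<subseteq> insert e B"
        then obtain vs es where c: "is_cycle G vs es" "set es \<subseteq> insert e B" by blast
        then have "e \<in> set es" using nocyc[OF c(1)] by blast
        then have "reach (ends G) (set es - {e}) x y" by (rule cycle_reach[OF c(1)]) (rule e)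
        then have "reach (ends G) B x y" by (rule reach_mono) (use c(2) in blast)
        then show False using n by blast
      qed
      then have "insert e B = B" using B unfolding spanning_forest_def by blast
      then have "e \<in> B" by blast
      then have "reach (ends G) B x y" using e(2) by (rule reach_edge)
      then show False using n by blast
    qed
  qed
  then obtain T where T: "T \<subseteq> B" "spanning_tree G T"
    using spanning_tree_exists[OF assms(1) sub _ G(2)] by blast
  have "B \<subseteq> T"
  proof
    fix f assume f: "f \<in> B"
    show "f \<in> T"
    proof (rule ccontr)
      assume "f \<notin> T"
      have "f \<in> edges G" using f sub by blast
      then obtain x y where xy: "ends G f = {x, y}" "x \<in> verts G" "y \<in> verts G"
        using loopless_ends[OF assms(1)] by metis
      then have "reach (ends G) T x y" using T(2) by (simp add: spanning_tree_def connects_def)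
      then obtain vs es where "is_cycle G vs es" "set es \<subseteq> insert f T"
        using reach_cycle[OF assms(1) _ \<open>f \<in> edges G\<close> \<open>f \<notin> T\<close> xy(1)] T sub by (metis subset_trans)
      then show False using nocyc f T(1) by blast
    qed
  qed
  then show "spanning_tree G B" using T by (metis subset_antisym)
next
  assume B: "spanning_tree G B"
  have "forest G B"
    unfolding forest_def
  proof (intro conjI notI)
    show "B \<subseteq> edges G" using B by (simp add: spanning_tree_def)
    assume "\<exists>vs es. is_cycle G vs es \<and> set es \<subseteq> B"
    then obtain vs es where c: "is_cycle G vs es" "set es \<subseteq> B" by blast
    then have "es \<noteq> []" by (auto simp: is_cycle_def)
    then obtain e where e: "e \<in> set es" by (meson hd_in_set)
    then have "e \<in> edges G" using c B by (auto simp: spanning_tree_def)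
    then obtain x y where xy: "ends G e = {x, y}" using loopless_ends[OF assms(1)] by metis
    have "reach (ends G) (set es - {e}) x y" by (rule cycle_reach[OF c(1) e xy])
    then have "reach (ends G) (B - {e}) x y" by (rule reach_mono) (use c(2) in blast)
    then show False using spanning_tree_bridge[OF assms(1) B _ xy] e c(2) by blast
  qed
  moreover have "F = B" if F: "forest G F" "B \<subseteq> F" for F
  proof (rule ccontr)
    assume "F \<noteq> B"
    then obtain f where f: "f \<in> F" "f \<notin> B" using F by blast
    then have "f \<in> edges G" using F by (auto simp: forest_def)
    then obtain x y where xy: "ends G f = {x, y}" "x \<in> verts G" "y \<in> verts G"
      using loopless_ends[OF assms(1)] by metis
    then have "reach (ends G) B x y" using B by (simp add: spanning_tree_def connects_def)
    moreover have "B \<subseteq> edges G" using B by (simp add: spanning_tree_def)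
    ultimately obtain vs es where "is_cycle G vs es" "set es \<subseteq> insert f B"
      using reach_cycle[OF assms(1) _ \<open>f \<in> edges G\<close> f(2) xy(1)] by metis
    then show False using F f(1) unfolding forest_def by blast
  qed
  ultimately show "spanning_forest G B" unfolding spanning_forest_def by blast
qed

section \<open>Spanning trees under deletion, restriction and contraction\<close>

lemma loopless_delete_edge: "loopless G \<Longrightarrow> loopless (delete_edge G e)"
  by (auto simp: loopless_def delete_edge_def)

lemma loopless_induced_subgraph:
  "loopless G \<Longrightarrow> S \<subseteq> verts G \<Longrightarrow> loopless (induced_subgraph G S)"
  by (auto simp: loopless_def induced_subgraph_def edges_within_def intro: finite_subset)

lemma spanning_tree_delete_edge:
  "spanning_tree (delete_edge G e) B \<longleftrightarrow> spanning_tree G B \<and> e \<notin> B"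
  by (auto simp: spanning_tree_def delete_edge_def)

lemma component_eq_reach: "component G F u = {v \<in> verts G. reach (ends G) F u v}"
  unfolding component_def reach_def adjacent_def by simp

lemma component_within:
  assumes "S \<subseteq> verts G" and "connects (ends G) S (edges_within G S)" and "u \<in> verts G"
  shows "component G (edges_within G S) u = (if u \<in> S then S else {u})"
proof -
  have out: "v = u" if "u \<notin> S" "reach (ends G) (edges_within G S) u v" for v
    using that(2) by (induction rule: reach_induct) (use that(1) in \<open>auto simp: edges_within_def\<close>)
  have "v \<in> S" if "u \<in> S" "reach (ends G) (edges_within G S) u v" for v
    using that(2) by (induction rule: reach_induct) (use that(1) in \<open>auto simp: edges_within_def\<close>)
  then show ?thesis using out assms by (auto simp: component_eq_reach connects_def)
qed

lemma contract_reach: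
  assumes "reach (ends G) B u v"
  shows "reach (ends (contract G F)) (B - F) (component G F u) (component G F v)"
  using assms
proof (rule reach_hom)
  fix e x y assume e: "e \<in> B" "ends G e = {x, y}"
  show "reach (ends (contract G F)) (B - F) (component G F x) (component G F y)"
  proof (cases "e \<in> F")
    case True
    then have "reach (ends G) F x y" using e by (intro reach_edge)
    then have "component G F x = component G F y"
      unfolding component_eq_reach by (blast intro: reach_trans reach_sym)
    then show ?thesis by simp
  next
    case False
    then show ?thesis using e by (intro reach_edge[of e]) (auto simp: contract_def)
  qed
qed

context
  fixes G :: "('v, 'e::finite) multigraph" and S :: "'v set"
  assumes loopless: "loopless G" and sub: "S \<subseteq> verts G" and nonempty: "S \<noteq> {}"
    and conn: "connects (ends G) S (edges_within G S)"
begin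

lemma contract_within_verts:
  "verts (contract G (edges_within G S)) = insert S ((\<lambda>u. {u}) ` (verts G - S))"
  using component_within[OF sub conn] sub nonempty by (force simp: contract_def)

lemma contract_within_card:
  "card (verts (contract G (edges_within G S))) + card S = card (verts G) + 1"
proof -
  have fin: "finite (verts G)" using loopless by (simp add: loopless_def)
  have "S \<notin> (\<lambda>u. {u}) ` (verts G - S)" by auto
  moreover have "card ((\<lambda>u. {u}) ` (verts G - S)) = card (verts G - S)"
    by (intro card_image) (auto simp: inj_on_def)
  ultimately have "card (verts (contract G (edges_within G S))) = card (verts G - S) + 1"
    using fin by (simp add: contract_within_verts)
  moreover have "card (verts G - S) = card (verts G) - card S" "card S \<le> card (verts G)"
    using fin sub by (auto intro: card_Diff_subset card_mono finite_subset)
  ultimately show ?thesis by simp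
qed

lemma loopless_contract_within: "loopless (contract G (edges_within G S))"
proof -
  have "component G (edges_within G S) ` ends G e \<subseteq> verts (contract G (edges_within G S)) \<and>
    card (component G (edges_within G S) ` ends G e) = 2" if e: "e \<in> edges G - edges_within G S" for e
  proof -
    obtain x y where xy: "ends G e = {x, y}" "x \<noteq> y" "x \<in> verts G" "y \<in> verts G"
      using loopless_ends[OF loopless] e by blast
    then have "\<not> (x \<in> S \<and> y \<in> S)" using e by (auto simp: edges_within_def)
    then have "component G (edges_within G S) x \<noteq> component G (edges_within G S) y"
      using xy component_within[OF sub conn] by auto
    then show ?thesis using xy by (simp add: contract_def)
  qed
  moreover have "finite (verts G)" using loopless by (simp add: loopless_def)
  ultimately show ?thesis unfolding loopless_def by (simp add: contract_def)
qed

lemma contract_connects: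
  assumes "connects (ends G) (verts G) B"
  shows "connects (ends (contract G F)) (verts (contract G F)) (B - F)"
  using assms contract_reach[of G B _ _ F] by (auto simp: connects_def contract_def)

text \<open>A walk in the contraction is lifted by representatives: a fixed \<open>s\<close> for the
  vertex \<open>S\<close>, the sole element for every other vertex. Gaps inside \<open>S\<close>
  between \<open>s\<close> and the actual ends of edges are filled by \<open>B1\<close>.\<close>

lemma uncontract_reach:
  assumes "B2 \<subseteq> edges G" and "connects (ends G) S B1" and "u \<in> verts G" and "v \<in> verts G"
    and "reach (ends (contract G (edges_within G S))) B2
      (component G (edges_within G S) u) (component G (edges_within G S) v)"
  shows "reach (ends G) (B1 \<union> B2) u v"
proof -
  let ?c = "component G (edges_within G S)"
  obtain s where s: "s \<in> S" using nonempty by blast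
  define p where "p X = (if X = S then s else the_elem X)" for X
  have p: "p (?c x) = (if x \<in> S then s else x)" if "x \<in> verts G" for x
    using that component_within[OF sub conn] by (auto simp: p_def)
  have px: "reach (ends G) (B1 \<union> B2) (p (?c x)) x" if "x \<in> verts G" for x
  proof (cases "x \<in> S")
    case True
    then have "reach (ends G) B1 s x" using assms(2) s by (simp add: connects_def)
    then show ?thesis using p[OF that] True reach_mono[of "ends G" B1 s x "B1 \<union> B2"] by simp
  qed (simp add: p that)
  have "reach (ends G) (B1 \<union> B2) (p (?c u)) (p (?c v))"
    using assms(5)
  proof (rule reach_hom)
    fix e X Y assume e: "e \<in> B2" "ends (contract G (edges_within G S)) e = {X, Y}"
    then have "e \<in> edges G" using assms(1) by blast
    then obtain x y where xy: "ends G e = {x, y}" "x \<in> verts G" "y \<in> verts G"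
      using loopless_ends[OF loopless] by metis
    have r: "reach (ends G) (B1 \<union> B2) x y" using e xy by (intro reach_edge[of e]) auto
    then have r1: "reach (ends G) (B1 \<union> B2) (p (?c x)) (p (?c y))"
      using px[OF xy(2)] px[OF xy(3)] by (meson reach_sym reach_trans)
    have "{?c x, ?c y} = {X, Y}" using e xy by (simp add: contract_def)
    then show "reach (ends G) (B1 \<union> B2) (p X) (p Y)"
      using r1 reach_sym[OF r1] by (auto simp: doubleton_eq_iff)
  qed
  then show ?thesis using px[OF assms(3)] px[OF assms(4)] by (meson reach_sym reach_trans)
qed

text \<open>The sizes match: \<open>|S| - 1\<close> edges inside and \<open>|V| - |S|\<close>
  outside give \<open>|V| - 1\<close>.\<close>

lemma spanning_tree_union:
  assumes "spanning_tree (induced_subgraph G S) B1"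
    and "spanning_tree (contract G (edges_within G S)) B2"
  shows "spanning_tree G (B1 \<union> B2)"
proof -
  have B1: "B1 \<subseteq> edges_within G S" "connects (ends G) S B1" "card B1 + 1 = card S"
    using assms(1) by (auto simp: spanning_tree_def induced_subgraph_def)
  have B2: "B2 \<subseteq> edges G - edges_within G S"
    using assms(2) by (auto simp: spanning_tree_def contract_def)
  have "connects (ends G) (verts G) (B1 \<union> B2)"
    unfolding connects_def
  proof (intro ballI)
    fix u v assume uv: "u \<in> verts G" "v \<in> verts G"
    have "reach (ends (contract G (edges_within G S))) B2
      (component G (edges_within G S) u) (component G (edges_within G S) v)"
      using assms(2) uv by (simp add: spanning_tree_def connects_def contract_def)
    then show "reach (ends G) (B1 \<union> B2) u v"
      using B1 B2 uv by (intro uncontract_reach) auto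
  qed
  moreover have "card (B1 \<union> B2) = card B1 + card B2"
    using B1 B2 by (intro card_Un_disjoint) auto
  moreover have "card B2 + 1 + card S = card (verts G) + 1"
    using contract_within_card assms(2) by (simp add: spanning_tree_def)
  moreover have "B1 \<union> B2 \<subseteq> edges G" using B1 B2 by (auto simp: edges_within_def)
  ultimately show ?thesis using B1(3) by (simp add: spanning_tree_def)
qed

text \<open>The edges of \<open>B\<close> outside \<open>E(S)\<close> connect the contraction, which
  takes at least \<open>|V| - |S|\<close> of them and leaves at most \<open>|S| - 1\<close> for
  \<open>E(S)\<close>. If this bound is attained, the outer part is a tree of the contraction; if
  the inner part connects \<open>S\<close>, the bound is attained.\<close>

lemma spanning_tree_split:
  assumes "spanning_tree G B"
  shows "card (B \<inter> edges_within G S) + 1 \<le> card S"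
    and "card (B \<inter> edges_within G S) + 1 = card S \<Longrightarrow>
      spanning_tree (contract G (edges_within G S)) (B - edges_within G S)"
    and "connects (ends G) S (B \<inter> edges_within G S) \<Longrightarrow>
      card (B \<inter> edges_within G S) + 1 = card S"
    and "connects (ends G) S (B \<inter> edges_within G S) \<Longrightarrow>
      spanning_tree (induced_subgraph G S) (B \<inter> edges_within G S)"
proof -
  let ?E = "edges_within G S"
  have B: "B \<subseteq> edges G" "connects (ends G) (verts G) B" "card B + 1 = card (verts G)"
    using assms by (auto simp: spanning_tree_def)
  have cB: "card (B \<inter> ?E) + card (B - ?E) = card B"
    using card_Un_disjoint[of "B \<inter> ?E" "B - ?E"] by (simp add: Int_Diff_Un Int_Diff_disjoint)
  have con: "connects (ends (contract G ?E)) (verts (contract G ?E)) (B - ?E)"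
    by (rule contract_connects[OF B(2)])
  moreover have "finite (verts (contract G ?E))"
    using loopless_contract_within by (simp add: loopless_def)
  moreover have "ends (contract G ?E) e \<subseteq> verts (contract G ?E)" if "e \<in> B - ?E" for e
  proof -
    have "e \<in> edges (contract G ?E)" using that B(1) by (auto simp: contract_def)
    then show ?thesis using loopless_contract_within unfolding loopless_def by blast
  qed
  ultimately have "card (verts (contract G ?E)) \<le> card (B - ?E) + 1"
    by (intro connects_card)
  then show le: "card (B \<inter> ?E) + 1 \<le> card S"
    using contract_within_card B(3) cB by linarith
  show "spanning_tree (contract G ?E) (B - ?E)" if "card (B \<inter> ?E) + 1 = card S"
  proof -
    have "card (B - ?E) + 1 = card (verts (contract G ?E))"
      using contract_within_card B(3) cB that by linarith
    moreover have "B - ?E \<subseteq> edges (contract G ?E)" using B(1) by (auto simp: contract_def)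
    ultimately show ?thesis using con by (simp add: spanning_tree_def)
  qed
  show eq: "card (B \<inter> ?E) + 1 = card S" if c: "connects (ends G) S (B \<inter> ?E)"
  proof -
    have "card S \<le> card (B \<inter> ?E) + 1"
      using c sub loopless by (intro connects_card) (auto simp: edges_within_def loopless_def intro: finite_subset)
    then show ?thesis using le by simp
  qed
  show "spanning_tree (induced_subgraph G S) (B \<inter> ?E)" if "connects (ends G) S (B \<inter> ?E)"
    using eq[OF that] that by (simp add: spanning_tree_def induced_subgraph_def)
qed

end

section \<open>Good flats and maximal trees\<close>

lemma simple_edges_within_ends:
  assumes "simple_graph G" and "e \<in> edges G"
  shows "edges_within G (ends G e) = {e}"
proof -
  have "f = e" if "f \<in> edges G" "ends G f \<subseteq> ends G e" for f
  proof -
    have "card (ends G f) = 2" "card (ends G e) = 2" using assms that by (auto simp: simple_graph_def)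
    then have "ends G f = ends G e" using that(2) by (metis card.infinite card_subset_eq zero_neq_numeral)
    then show ?thesis using assms that(1) by (auto simp: simple_graph_def inj_on_def)
  qed
  then show ?thesis using assms(2) by (auto simp: edges_within_def)
qed

lemma edge_connects_ends:
  assumes "ends G e = {a, b}" and "e \<in> F"
  shows "connects (ends G) {a, b} F"
proof -
  have "reach (ends G) F a b" using assms by (intro reach_edge)
  then show ?thesis by (auto simp: connects_def intro: reach_sym)
qed

text \<open>A cut vertex \<open>z\<close> of the graph without \<open>e\<close> must separate the
  ends \<open>a\<close> and \<open>b\<close> of \<open>e\<close>. In the contraction only the merged
  vertex is in danger, so the point is that removing both \<open>a\<close> and \<open>b\<close>
  leaves a connected graph: every remaining vertex still reaches \<open>z\<close> on its own side of
  the separation.\<close>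

lemma contract_or_delete_two_connected:
  fixes G :: "('v, 'e::finite) multigraph"
  assumes "simple_graph G" and "two_connected G" and "3 \<le> card (verts G)" and "e \<in> edges G"
    and "\<not> two_connected (delete_edge G e)"
  shows "two_connected (contract G {e})"
proof -
  let ?V = "verts G" and ?E = "edges G"
  have ll: "loopless G" using assms(1) by (rule simple_graph_loopless)
  have fin: "finite ?V" using ll by (simp add: loopless_def)
  obtain a b where ab: "ends G e = {a, b}" "a \<noteq> b" "a \<in> ?V" "b \<in> ?V"
    using loopless_ends[OF ll assms(4)] by metis
  have del: "connects (ends G) (?V - {x}) {f \<in> ?E. x \<notin> ends G f}" if "x \<in> ?V" for x
    using two_connected_delete_vertex[OF assms(2) that]
    by (simp add: connected_graph_iff delete_vertex_def)
  have third: "\<exists>z\<in>?V. z \<noteq> x \<and> z \<noteq> y" for x y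
  proof (rule ccontr)
    assume "\<not> ?thesis"
    then have "?V \<subseteq> {x, y}" by blast
    then have "card ?V \<le> card {x, y}" by (intro card_mono) auto
    then show False using assms(3) card_insert_le_m1[of 2 "{y}" x] by simp
  qed
  \<comment> \<open>Vertices other than \<open>a\<close> reach \<open>b\<close> after removal of
    \<open>a\<close>, which also removes \<open>e\<close>. The vertex \<open>a\<close> first reaches
    a third vertex after removal of \<open>b\<close>; this is where three vertices are
    needed.\<close>
  have "connects (ends G) ?V (?E - {e})"
  proof (rule connectsI[where a = b])
    have *: "reach (ends G) (?E - {e}) u b" if "u \<in> ?V" "u \<noteq> a" for u
    proof -
      have "reach (ends G) {f \<in> ?E. a \<notin> ends G f} u b"
        using del[OF ab(3)] that ab by (simp add: connects_def)
      then show ?thesis by (rule reach_mono) (use ab in auto)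
    qed
    fix u assume "u \<in> ?V"
    show "reach (ends G) (?E - {e}) u b"
    proof (cases "u = a")
      case True
      obtain c where c: "c \<in> ?V" "c \<noteq> a" "c \<noteq> b" using third by blast
      then have "reach (ends G) {f \<in> ?E. b \<notin> ends G f} a c"
        using del[OF ab(4)] ab by (simp add: connects_def)
      then have "reach (ends G) (?E - {e}) a c" by (rule reach_mono) (use ab in auto)
      then show ?thesis using True *[OF c(1,2)] by (blast intro: reach_trans)
    qed (use * \<open>u \<in> ?V\<close> in blast)
  qed
  then have "connected_graph (delete_edge G e)"
    using ab by (auto simp: connected_graph_iff delete_edge_def)
  then obtain z where "cut_vertex (delete_edge G e) z"
    using assms(3,5) by (auto simp: two_connected_def delete_edge_def)
  then have z: "z \<in> ?V" and "\<not> connected_graph (delete_vertex (delete_edge G e) z)"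
    by (auto simp: cut_vertex_def delete_edge_def)
  moreover have "?V - {z} \<noteq> {}" using third[of z z] by blast
  ultimately have ncon: "\<not> connects (ends G) (?V - {z}) {f \<in> ?E - {e}. z \<notin> ends G f}"
    by (simp add: connected_graph_iff delete_vertex_def delete_edge_def)
  have "z \<notin> ends G e"
  proof
    assume "z \<in> ends G e"
    then have "{f \<in> ?E. z \<notin> ends G f} = {f \<in> ?E - {e}. z \<notin> ends G f}" by auto
    then show False using del[OF z] ncon by simp
  qed
  then have zab: "z \<noteq> a" "z \<noteq> b" using ab by auto
  let ?Ez = "{f \<in> ?E - {e}. z \<notin> ends G f}"
  \<comment> \<open>Without \<open>z\<close> the graph is connected, without \<open>z\<close> and
    \<open>e\<close> it is not; so \<open>e\<close> is a bridge there.\<close>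
  have nab: "\<not> reach (ends G) ?Ez a b"
  proof
    assume r: "reach (ends G) ?Ez a b"
    have "connects (ends G) (?V - {z}) ?Ez"
    proof (rule connects_subst[OF del[OF z]])
      fix f x y assume f: "f \<in> {f \<in> ?E. z \<notin> ends G f}" "ends G f = {x, y}"
      show "reach (ends G) ?Ez x y"
      proof (cases "f = e")
        case True
        then show ?thesis using f ab r reach_sym[OF r] by (auto simp: doubleton_eq_iff)
      next
        case False
        then show ?thesis using f by (intro reach_edge[of f]) auto
      qed
    qed
    then show False using ncon by blast
  qed
  let ?Eab = "{f \<in> ?E. ends G f \<inter> {a, b} = {}}"
  \<comment> \<open>\<open>A\<close> is one side, containing neither \<open>z\<close> nor the end
    \<open>q\<close> of \<open>e\<close>. Removing the other end \<open>p\<close> leaves a walk from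
    \<open>y\<close> to \<open>z\<close>; collapsing everything outside \<open>A\<close> to
    \<open>z\<close> keeps it a walk, because edges out of \<open>A\<close> other than
    \<open>e\<close> lead to \<open>z\<close>, and the result avoids both ends of
    \<open>e\<close>.\<close>
  have side: "reach (ends G) ?Eab y z"
    if A: "p \<in> {a, b}" "q \<in> {a, b}" "p \<noteq> q" "q \<notin> A" "A \<subseteq> ?V - {z}" "y \<in> A" "y \<noteq> p"
      and cl: "\<And>f x x'. f \<in> ?Ez \<Longrightarrow> ends G f = {x, x'} \<Longrightarrow> x \<in> A \<Longrightarrow> x' \<in> A" for A p q y
  proof -
    define h where "h x = (if x \<in> A then x else z)" for x
    have pq: "{a, b} = {p, q}" "p \<in> ?V" "z \<noteq> p" "z \<noteq> q" using A ab zab by auto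
    have edge: "reach (ends G) ?Eab (h x) (h x')"
      if f: "f \<in> ?E" "p \<notin> ends G f" "ends G f = {x, x'}" and x: "x \<in> A" for f x x'
    proof (cases "x' \<in> A")
      case True
      then have "f \<in> ?Eab" using f x A pq by auto
      then show ?thesis using True x f(3) by (auto simp: h_def intro: reach_edge)
    next
      case False
      have "f \<noteq> e" using f ab pq by auto
      then have "z \<in> ends G f" using cl[of f x x'] f x False by blast
      then have "x' = z" using f x A by auto
      then have "f \<in> ?Eab" using f x A pq by auto
      then show ?thesis using False x f(3) \<open>x' = z\<close> by (auto simp: h_def intro: reach_edge)
    qed
    have "reach (ends G) {f \<in> ?E. p \<notin> ends G f} y z"
      using del[OF pq(2)] A pq z by (auto simp: connects_def)
    then have "reach (ends G) ?Eab (h y) (h z)"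
    proof (rule reach_hom)
      fix f x x' assume f: "f \<in> {f \<in> ?E. p \<notin> ends G f}" "ends G f = {x, x'}"
      show "reach (ends G) ?Eab (h x) (h x')"
      proof (cases "x \<in> A")
        case True
        then show ?thesis using edge f by blast
      next
        case False
        show ?thesis
        proof (cases "x' \<in> A")
          case True
          have "ends G f = {x', x}" using f(2) by auto
          then have "reach (ends G) ?Eab (h x') (h x)" using edge[of f x' x] True f(1) by simp
          then show ?thesis by (rule reach_sym)
        next
          case False
          then show ?thesis using \<open>x \<notin> A\<close> by (simp add: h_def)
        qed
      qed
    qed
    then show ?thesis using A by (auto simp: h_def)
  qed
  \<comment> \<open>The side of \<open>a\<close>. Its complement apart from \<open>z\<close> is
    closed in the same sense and contains \<open>b\<close>, so \<open>side\<close> applies to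
    both.\<close>
  define A where "A = {x \<in> ?V - {z}. reach (ends G) ?Ez a x}"
  have clA: "x' \<in> A" if "f \<in> ?Ez" "ends G f = {x, x'}" "x \<in> A" for f x x'
  proof -
    have "x' \<in> ?V" "x' \<noteq> z" using that ll by (auto simp: loopless_def)
    moreover have "reach (ends G) ?Ez x x'" using that by (intro reach_edge)
    ultimately show ?thesis using that(3) unfolding A_def by (blast intro: reach_trans)
  qed
  have "b \<notin> A" "a \<in> A" using nab ab zab by (auto simp: A_def)
  have toz: "reach (ends G) ?Eab y z" if "y \<in> ?V" "y \<notin> {a, b}" for y
  proof (cases "y = z")
    case False
    show ?thesis
    proof (cases "y \<in> A")
      case True
      show ?thesis
        by (rule side[of a b A]) (use True that ab \<open>b \<notin> A\<close> clA in \<open>auto simp: A_def\<close>)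
    next
      case nA: False
      show ?thesis
      proof (rule side[of b a "?V - {z} - A"])
        fix f x x' assume f: "f \<in> ?Ez" "ends G f = {x, x'}" "x \<in> ?V - {z} - A"
        then have "x' \<in> ?V" "x' \<noteq> z" using ll by (auto simp: loopless_def)
        moreover have "ends G f = {x', x}" using f by auto
        then have "x' \<notin> A" using clA[OF f(1)] f(3) by blast
        ultimately show "x' \<in> ?V - {z} - A" by blast
      qed (use nA False that ab \<open>a \<in> A\<close> in auto)
    qed
  qed simp
  let ?S = "{a, b}" and ?F = "edges_within G {a, b}"
  have Fe: "?F = {e}" using simple_edges_within_ends[OF assms(1,4)] ab by simp
  have conS: "connects (ends G) ?S ?F" using Fe ab(1) by (intro edge_connects_ends) auto
  have S: "?S \<subseteq> ?V" "?S \<noteq> {}" using ab by auto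
  note within = ll S conS
  let ?C = "contract G ?F" and ?c = "component G ?F"
  have c: "?c u = (if u \<in> ?S then ?S else {u})" if "u \<in> ?V" for u
    using component_within[OF S(1) conS that] .
  have vC: "verts ?C = ?c ` ?V" by (simp add: contract_def)
  have "connects (ends ?C) (verts ?C) (?E - ?F)"
    using assms(2) by (intro contract_connects[OF within]) (auto simp: two_connected_def connected_graph_iff)
  then have "connected_graph ?C" using ab by (auto simp: connected_graph_iff contract_def)
  moreover have "2 \<le> card (verts ?C)"
    using contract_within_card[OF within] assms(3) ab(2) by simp
  moreover have "\<not> cut_vertex ?C X" for X
  proof
    assume cv: "cut_vertex ?C X"
    then obtain x where x: "x \<in> ?V" "X = ?c x" by (auto simp: cut_vertex_def vC)
    \<comment> \<open>For the merged vertex all others reach \<open>z\<close> by \<open>toz\<close>;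
      for any other vertex the image of the connected graph without \<open>x\<close>
      suffices.\<close>
    have "connected_graph (delete_vertex ?C X)"
    proof (cases "x \<in> ?S")
      case True
      then have X: "X = ?S" using c x by simp
      have "reach (ends ?C) {f \<in> ?E - ?F. X \<notin> ends ?C f} (?c u) (?c v)"
        if "u \<in> ?V" "v \<in> ?V" "?c u \<noteq> X" "?c v \<noteq> X" for u v
      proof -
        have "u \<notin> ?S" "v \<notin> ?S" using that c X by auto
        then have "reach (ends G) ?Eab u z" "reach (ends G) ?Eab v z" using toz that by auto
        then have "reach (ends G) ?Eab u v" by (meson reach_sym reach_trans)
        from contract_reach[OF this, of ?F]
        show ?thesis
        proof (rule reach_mono)
          show "?Eab - ?F \<subseteq> {f \<in> ?E - ?F. X \<notin> ends ?C f}"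
          proof
            fix f assume f: "f \<in> ?Eab - ?F"
            then have "ends G f \<subseteq> ?V" using ll by (auto simp: loopless_def)
            then have "?c y \<noteq> X" if "y \<in> ends G f" for y
              using that c[of y] f X by (auto split: if_splits)
            then show "f \<in> {f \<in> ?E - ?F. X \<notin> ends ?C f}" using f by (auto simp: contract_def)
          qed
        qed
      qed
      moreover have "?c z \<in> verts ?C - {X}" using z c[OF z] zab X vC by auto
      ultimately show ?thesis
        unfolding connected_graph_iff connects_def delete_vertex_def
        by (auto simp: contract_def)
    next
      case False
      then have X: "X = {x}" using c x by simp
      have "reach (ends ?C) {f \<in> ?E - ?F. X \<notin> ends ?C f} (?c u) (?c v)"
        if "u \<in> ?V" "v \<in> ?V" "?c u \<noteq> X" "?c v \<noteq> X" for u v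
      proof -
        have "u \<noteq> x" "v \<noteq> x" using that x by auto
        then have "reach (ends G) {f \<in> ?E. x \<notin> ends G f} u v"
          using del[OF x(1)] that by (simp add: connects_def)
        from contract_reach[OF this, of ?F]
        show ?thesis
        proof (rule reach_mono)
          show "{f \<in> ?E. x \<notin> ends G f} - ?F \<subseteq> {f \<in> ?E - ?F. X \<notin> ends ?C f}"
          proof
            fix f assume f: "f \<in> {f \<in> ?E. x \<notin> ends G f} - ?F"
            then have "ends G f \<subseteq> ?V" using ll by (auto simp: loopless_def)
            then have "?c y \<noteq> X" if "y \<in> ends G f" for y
              using that c[of y] f X ab(2) by (auto split: if_splits)
            then show "f \<in> {f \<in> ?E - ?F. X \<notin> ends ?C f}" using f by (auto simp: contract_def)
          qed
        qed
      qed
      moreover have "?c a \<in> verts ?C - {X}" using c[OF ab(3)] ab X vC by auto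
      ultimately show ?thesis
        unfolding connected_graph_iff connects_def delete_vertex_def
        by (auto simp: contract_def)
    qed
    then show False using cv by (simp add: cut_vertex_def)
  qed
  ultimately show ?thesis using Fe by (simp add: two_connected_def)
qed

text \<open>Two vertices joined by one edge induce a 2-connected graph, so only the contraction
  matters. The condition on contractible edges thus becomes the flat condition for two vertices,
  \<open>w(e) + 1 = \<delta>\<close>.\<close>

lemma edge_good_flat:
  fixes G :: "('v, 'e::finite) multigraph"
  assumes "simple_graph G" and "e \<in> edges G"
  shows "two_connected (contract G {e}) \<longleftrightarrow> good_flat G (ends G e)"
proof -
  have ll: "loopless G" using assms(1) by (rule simple_graph_loopless)
  obtain a b where ab: "ends G e = {a, b}" "a \<noteq> b" "a \<in> verts G" "b \<in> verts G"
    using loopless_ends[OF ll assms(2)] by metis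
  have Fe: "edges_within G {a, b} = {e}" using simple_edges_within_ends[OF assms] ab by simp
  have "connects (ends G) {a, b} {e}" using ab by (intro edge_connects_ends) auto
  moreover have "\<not> cut_vertex (induced_subgraph G {a, b}) x" for x
    using ab(2) by (auto simp: cut_vertex_def connected_graph_iff connects_def
      delete_vertex_def induced_subgraph_def)
  ultimately have "two_connected (induced_subgraph G {a, b})"
    using ab(2) by (auto simp: two_connected_def connected_graph_iff induced_subgraph_def Fe)
  then show ?thesis using ab Fe by (simp add: good_flat_def)
qed

text \<open>The assumption \<open>unique\<close> says that the maximal trees span a facet.\<close>

lemma tight_trees_classification:
  fixes G :: "('v, 'e::finite) multigraph" and c :: "'e \<Rightarrow> real"
  assumes "simple_graph G" and "two_connected G"
    and max: "\<And>B. spanning_tree G B \<Longrightarrow> sum c B \<le> M"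
    and tight: "spanning_tree G B0" "sum c B0 = M"
    and e0: "e0 \<in> edges G" "f0 \<in> edges G" "c e0 \<noteq> c f0"
    and unique: "\<And>(d :: 'e \<Rightarrow> real) k. (\<And>B. spanning_tree G B \<Longrightarrow> sum c B = M \<Longrightarrow> sum d B = k) \<Longrightarrow>
      \<exists>s t. \<forall>e\<in>edges G. d e = s * c e + t"
  shows "(\<exists>e\<in>edges G. two_connected (delete_edge G e) \<and>
        (\<forall>B. spanning_tree G B \<longrightarrow> sum c B = M \<longrightarrow> e \<notin> B)) \<or>
    (\<exists>S. good_flat G S \<and>
        (\<forall>B. spanning_tree G B \<longrightarrow> sum c B = M \<longrightarrow> card (B \<inter> edges_within G S) + 1 = card S))"
proof -
  let ?tight = "\<lambda>B. spanning_tree G B \<and> sum c B = M"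
  let ?E = "edges G" and ?V = "verts G"
  have ll: "loopless G" using assms(1) by (rule simple_graph_loopless)
  \<comment> \<open>By \<open>unique\<close> a weighting with constant sum on tight trees is affine
    in \<open>c\<close>, hence constant wherever \<open>c\<close> is. This will refute nonconstant
    weightings coming from minors, with \<open>D\<close> the edge set of the minor.\<close>
  have const_on: "d e = d f"
    if D: "\<And>e. e \<in> ?E - D \<Longrightarrow> d e = 0" "\<And>B. ?tight B \<Longrightarrow> sum d B = k"
      and cD: "\<And>e f. e \<in> D \<Longrightarrow> f \<in> D \<Longrightarrow> c e = c f" "D \<subseteq> ?E" and ef: "e \<in> D" "f \<in> D"
    for d :: "'e \<Rightarrow> real" and D k e f
  proof -
    obtain s t where "\<forall>e\<in>?E. d e = s * c e + t" using unique[of d k] D(2) by blast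
    moreover have "e \<in> ?E" "f \<in> ?E" using ef cD(2) by auto
    ultimately show ?thesis using cD(1)[OF ef] by simp
  qed
  have extend: "\<exists>d. (\<forall>e\<in>D. d e = d0 e) \<and> (\<forall>e\<in>?E - D. d e = 0) \<and> (\<forall>B. sum d B = sum d0 (B \<inter> D))"
    for d0 :: "'e \<Rightarrow> real" and D
    by (intro exI[of _ "\<lambda>e. if e \<in> D then d0 e else 0"]) (simp add: sum.If_cases Int_def)
  show ?thesis
  proof (cases "\<exists>e\<in>?E. \<forall>B. ?tight B \<longrightarrow> e \<notin> B")
    case True
    then obtain e where e: "e \<in> ?E" "\<And>B. ?tight B \<Longrightarrow> e \<notin> B" by blast
    have tree_e: "spanning_tree (delete_edge G e) B" if "?tight B" for B
      using that e(2) by (simp add: spanning_tree_delete_edge)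
    have "sum (\<lambda>f. if f = e then 1 else 0 :: real) B = 0" if "?tight B" for B
      using e(2)[OF that] by (simp add: sum.delta')
    then obtain s t where st: "\<forall>f\<in>?E. (if f = e then 1 else 0) = s * c f + t"
      using unique[of "\<lambda>f. if f = e then 1 else 0" 0] by blast
    \<comment> \<open>The indicator of \<open>e\<close> is not constant, since \<open>e0\<close> and
      \<open>f0\<close> are distinct edges. With \<open>s\<close> nonzero, \<open>c\<close> is
      constant away from \<open>e\<close>.\<close>
    have "s \<noteq> 0"
    proof
      assume "s = 0"
      then have "t = (if f = e then 1 else 0)" if "f \<in> ?E" for f using st that by simp
      then show False using e0 e(1) by (metis zero_neq_one)
    qed
    then have cc: "c f = c g" if "f \<in> ?E - {e}" "g \<in> ?E - {e}" for f g
      using st that by (metis DiffE add_right_cancel insertI1 mult_cancel_left)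
    \<comment> \<open>Otherwise the minor has a nonconstant weighting with constant tree sums;
      extended by zero it has constant sum on tight trees and contradicts \<open>const_on\<close>.
      The same argument is repeated below for the subgraph induced on \<open>S\<close> and for the
      contraction.\<close>
    have "two_connected (delete_edge G e)"
    proof (rule ccontr)
      assume n: "\<not> two_connected (delete_edge G e)"
      have conn: "connects (ends G) ?V (?E - {e})"
        using tree_e[of B0] tight by (auto simp: spanning_tree_def delete_edge_def intro: connects_mono)
      then have 1: "connected_graph (delete_edge G e)" "2 \<le> card (verts (delete_edge G e))"
        using assms(2) by (auto simp: two_connected_def connected_graph_iff delete_edge_def)
      obtain d0 :: "'e \<Rightarrow> real" and f g k where d0: "f \<in> edges (delete_edge G e)"
        "g \<in> edges (delete_edge G e)" "d0 f \<noteq> d0 g"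
        "\<And>B. spanning_tree (delete_edge G e) B \<Longrightarrow> sum d0 B = k"
        using not_two_connected_flexible[OF loopless_delete_edge[OF ll] 1 n] by metis
      obtain d where d: "\<forall>f\<in>?E - {e}. d f = d0 f" "\<forall>f\<in>?E - (?E - {e}). d f = 0"
        "\<forall>B. sum d B = sum d0 (B \<inter> (?E - {e}))" using extend[of "?E - {e}" d0] by blast
      have dk: "sum d B = k" if B: "?tight B" for B
      proof -
        have "B \<inter> (?E - {e}) = B" using e(2)[OF B] B by (auto simp: spanning_tree_def)
        then show ?thesis using d(3) d0(4)[OF tree_e[OF B]] by simp
      qed
      have fg: "f \<in> ?E - {e}" "g \<in> ?E - {e}" using d0(1,2) by (simp_all add: delete_edge_def)
      have "d f = d g" by (rule const_on[OF bspec[OF d(2)] dk cc Diff_subset fg])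
      then show False using d0(3) d(1) fg by simp
    qed
    then show ?thesis using e by blast
  next
    case False
    then have cover: "\<exists>B. ?tight B \<and> e \<in> B" if "e \<in> ?E" for e using that by blast
    \<comment> \<open>Tight trees are the trees of maximum weight, so, as in Kruskal's algorithm,
      each of them must span every component of the set \<open>A\<close> of heaviest edges.\<close>
    define m where "m = Max (c ` ?E)"
    define A where "A = {e \<in> ?E. c e = m}"
    have le: "c e \<le> m" if "e \<in> ?E" for e using that by (simp add: m_def)
    have "m \<in> c ` ?E" unfolding m_def using e0 by (intro Max_in) auto
    then obtain e1 where e1: "e1 \<in> A" by (auto simp: A_def)
    have "\<not> (e0 \<in> A \<and> f0 \<in> A)" using e0(3) by (simp add: A_def)
    then have "A \<noteq> ?E" using e0(1,2) by blast
    \<comment> \<open>Otherwise an exchange that protects \<open>B \<inter> A\<close> would bring in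
      \<open>e\<close> for a lighter edge and exceed the maximum \<open>M\<close>.\<close>
    have spanA: "reach (ends G) (B \<inter> A) x y"
      if B: "?tight B" and e: "e \<in> A" "ends G e = {x, y}" for B e x y
    proof (rule ccontr)
      assume n: "\<not> reach (ends G) (B \<inter> A) x y"
      have "e \<notin> B" using n e reach_edge[of e "B \<inter> A" "ends G" x y] by auto
      moreover have "e \<in> ?E" using e by (simp add: A_def)
      moreover have "x \<in> ?V" "y \<in> ?V" using \<open>e \<in> ?E\<close> e ll by (auto simp: loopless_def)
      ultimately obtain f where f: "f \<in> B" "f \<notin> B \<inter> A" "spanning_tree G (insert e (B - {f}))"
        using spanning_tree_exchange[of G B e "B \<inter> A" x y] B e(2) n by blast
      have "f \<in> ?E" using f B by (auto simp: spanning_tree_def)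
      then have "c f < m" using f le[of f] by (force simp: A_def)
      moreover have "sum c (insert e (B - {f})) = c e + (sum c B - c f)"
        using f(1) \<open>e \<notin> B\<close> by (simp add: sum_diff1)
      moreover have "sum c (insert e (B - {f})) \<le> M" using max f(3) by blast
      moreover have "c e = m" using e by (simp add: A_def)
      ultimately show False using B by simp
    qed
    have "e1 \<in> ?E" using e1 by (simp add: A_def)
    then obtain a b where ab: "ends G e1 = {a, b}" "a \<noteq> b" "a \<in> ?V" "b \<in> ?V"
      using loopless_ends[OF ll] by metis
    define S where "S = {v \<in> ?V. reach (ends G) A a v}"
    have "reach (ends G) A a b" using e1 ab(1) by (rule reach_edge)
    then have "a \<in> S" "b \<in> S" using ab by (auto simp: S_def)
    let ?F = "edges_within G S"
    have AS: "e \<in> ?F" if "e \<in> A" "ends G e = {x, y}" "x \<in> S" for e x y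
    proof -
      have "e \<in> ?E" using that by (simp add: A_def)
      then have "y \<in> ?V" using that ll by (auto simp: loopless_def)
      moreover have "reach (ends G) A x y" using that by (intro reach_edge)
      ultimately have "y \<in> S" using that(3) by (auto simp: S_def intro: reach_trans)
      then show ?thesis using that \<open>e \<in> ?E\<close> by (simp add: edges_within_def)
    qed
    have conB: "connects (ends G) S (B \<inter> ?F)" if B: "?tight B" for B
    proof (rule connectsI[where a = a])
      fix u assume "u \<in> S"
      define h where "h x = (if x \<in> S then x else a)" for x
      have "reach (ends G) A a u" using \<open>u \<in> S\<close> by (simp add: S_def)
      then have "reach (ends G) (B \<inter> A) a u"
        using reach_hom[of "ends G" A a u "ends G" "B \<inter> A" "\<lambda>x. x"] spanA[OF B] by blast
      then have "reach (ends G) (B \<inter> ?F) (h a) (h u)"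
      proof (rule reach_hom)
        fix e x y assume e: "e \<in> B \<inter> A" "ends G e = {x, y}"
        have "ends G e = {y, x}" using e by auto
        show "reach (ends G) (B \<inter> ?F) (h x) (h y)"
        proof (cases "x \<in> S \<or> y \<in> S")
          case True
          then have "e \<in> ?F" using AS[of e x y] AS[of e y x] e \<open>ends G e = {y, x}\<close> by blast
          then have "x \<in> S" "y \<in> S" using e(2) by (auto simp: edges_within_def)
          then show ?thesis using e \<open>e \<in> ?F\<close> by (auto simp: h_def intro: reach_edge)
        next
          case False
          then show ?thesis by (simp add: h_def)
        qed
      qed
      then show "reach (ends G) (B \<inter> ?F) u a"
        using \<open>a \<in> S\<close> \<open>u \<in> S\<close> by (simp add: h_def reach_sym)
    qed
    have "S \<subseteq> ?V" by (auto simp: S_def)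
    have "S \<noteq> {}" using \<open>a \<in> S\<close> by blast
    have conF: "connects (ends G) S ?F"
      using conB[of B0] tight by (auto intro: connects_mono)
    note within = ll \<open>S \<subseteq> ?V\<close> \<open>S \<noteq> {}\<close> conF
    have cardS: "card (B \<inter> ?F) + 1 = card S" if B: "?tight B" for B
      using spanning_tree_split(3)[OF within] B conB[OF B] by blast
    \<comment> \<open>A lighter edge inside \<open>S\<close> lies on some tight tree by
      \<open>cover\<close>, but there its ends are already joined by heaviest edges, which is
      impossible for a tree edge.\<close>
    have "?F \<subseteq> A"
    proof
      fix f assume f: "f \<in> ?F"
      show "f \<in> A"
      proof (rule ccontr)
        assume "f \<notin> A"
        have "f \<in> ?E" using f by (simp add: edges_within_def)
        then obtain B where B: "?tight B" "f \<in> B" using cover by blast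
        obtain x y where xy: "ends G f = {x, y}" using loopless_ends[OF ll \<open>f \<in> ?E\<close>] by metis
        then have "x \<in> S" "y \<in> S" using f by (auto simp: edges_within_def)
        then have "reach (ends G) A a x" "reach (ends G) A a y" by (auto simp: S_def)
        then have "reach (ends G) A x y" by (meson reach_trans reach_sym)
        then have "reach (ends G) (B \<inter> A) x y"
          using reach_hom[of "ends G" A x y "ends G" "B \<inter> A" "\<lambda>x. x"] spanA[OF B(1)] by blast
        then have "reach (ends G) (B - {f}) x y" by (rule reach_mono) (use \<open>f \<notin> A\<close> in blast)
        then show False using spanning_tree_bridge[OF ll _ B(2) xy] B(1) by blast
      qed
    qed
    have "?F \<subseteq> ?E" by (auto simp: edges_within_def)
    have cF: "c e = c f" if "e \<in> ?F" "f \<in> ?F" for e f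
      using that \<open>?F \<subseteq> A\<close> by (auto simp: A_def)
    have "e1 \<in> ?F" using \<open>a \<in> S\<close> AS[OF e1 ab(1)] by blast
    \<comment> \<open>Constant on tight trees, the indicator of \<open>E(S)\<close> is affine in
      \<open>c\<close>; hence \<open>c\<close> takes a single value outside \<open>E(S)\<close> as
      well, and \<open>const_on\<close> becomes available for both parts.\<close>
    have sumF: "sum (\<lambda>e. if e \<in> ?F then 1 else 0 :: real) B = real (card S) - 1" if B: "?tight B" for B
    proof -
      have "sum (\<lambda>e. if e \<in> ?F then 1 else 0 :: real) B = card (B \<inter> ?F)"
        by (simp add: sum.If_cases)
      then show ?thesis using cardS[OF B] by linarith
    qed
    have "\<exists>s t. \<forall>e\<in>?E. (if e \<in> ?F then 1 else 0) = s * c e + t"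
      by (rule unique[where k = "real (card S) - 1"]) (simp add: sumF)
    then obtain s t where st: "\<forall>e\<in>?E. (if e \<in> ?F then 1 else 0) = s * c e + t" by blast
    have "A \<subseteq> ?E" by (auto simp: A_def)
    then obtain g where g: "g \<in> ?E" "g \<notin> ?F" using \<open>?F \<subseteq> A\<close> \<open>A \<noteq> ?E\<close> by blast
    have "s \<noteq> 0"
    proof
      assume "s = 0"
      then have "t = 1" "t = 0" using bspec[OF st \<open>e1 \<in> ?E\<close>] bspec[OF st g(1)] g \<open>e1 \<in> ?F\<close> by auto
      then show False by simp
    qed
    then have cnF: "c e = c f" if "e \<in> ?E - ?F" "f \<in> ?E - ?F" for e f
    proof -
      have "s * c e + t = s * c f + t" using bspec[OF st, of e] bspec[OF st, of f] that by simp
      then show ?thesis using \<open>s \<noteq> 0\<close> by simp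
    qed
    have two_ind: "two_connected (induced_subgraph G S)"
    proof (rule ccontr)
      assume n: "\<not> two_connected (induced_subgraph G S)"
      have 1: "connected_graph (induced_subgraph G S)"
        using conF \<open>S \<noteq> {}\<close> by (simp add: connected_graph_iff induced_subgraph_def)
      have "card {a, b} \<le> card S"
        using \<open>a \<in> S\<close> \<open>b \<in> S\<close> \<open>S \<subseteq> ?V\<close> ll by (intro card_mono) (auto simp: loopless_def intro: finite_subset)
      then have 2: "2 \<le> card (verts (induced_subgraph G S))"
        using ab(2) by (simp add: induced_subgraph_def)
      obtain d0 :: "'e \<Rightarrow> real" and f g k where d0: "f \<in> edges (induced_subgraph G S)"
        "g \<in> edges (induced_subgraph G S)" "d0 f \<noteq> d0 g"
        "\<And>B. spanning_tree (induced_subgraph G S) B \<Longrightarrow> sum d0 B = k"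
        using not_two_connected_flexible[OF loopless_induced_subgraph[OF ll \<open>S \<subseteq> ?V\<close>] 1 2 n] by metis
      obtain d where d: "\<forall>f\<in>?F. d f = d0 f" "\<forall>f\<in>?E - ?F. d f = 0"
        "\<forall>B. sum d B = sum d0 (B \<inter> ?F)" using extend[of ?F d0] by blast
      have dk: "sum d B = k" if B: "?tight B" for B
        using d(3) d0(4) spanning_tree_split(4)[OF within _ conB[OF B]] B by simp
      have fg: "f \<in> ?F" "g \<in> ?F" using d0(1,2) by (simp_all add: induced_subgraph_def)
      have "d f = d g" by (rule const_on[OF bspec[OF d(2)] dk cF \<open>?F \<subseteq> ?E\<close> fg])
      then show False using d0(3) d(1) fg by simp
    qed
    have two_con: "two_connected (contract G ?F)"
    proof (rule ccontr)
      assume n: "\<not> two_connected (contract G ?F)"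
      have "connects (ends (contract G ?F)) (verts (contract G ?F)) (?E - ?F)"
        using assms(2) by (intro contract_connects[OF within]) (auto simp: two_connected_def connected_graph_iff)
      then have 1: "connected_graph (contract G ?F)"
        using ab by (auto simp: connected_graph_iff contract_def)
      have "S \<noteq> ?V"
      proof
        assume "S = ?V"
        then have "?F = ?E" using ll by (auto simp: edges_within_def loopless_def)
        then show False using g by simp
      qed
      then have "card S < card ?V" using \<open>S \<subseteq> ?V\<close> ll by (intro psubset_card_mono) (auto simp: loopless_def)
      then have 2: "2 \<le> card (verts (contract G ?F))" using contract_within_card[OF within] by simp
      obtain d0 :: "'e \<Rightarrow> real" and f g k where d0: "f \<in> edges (contract G ?F)"
        "g \<in> edges (contract G ?F)" "d0 f \<noteq> d0 g"
        "\<And>B. spanning_tree (contract G ?F) B \<Longrightarrow> sum d0 B = k"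
        using not_two_connected_flexible[OF loopless_contract_within[OF within] 1 2 n] by metis
      obtain d where d: "\<forall>f\<in>?E - ?F. d f = d0 f" "\<forall>f\<in>?E - (?E - ?F). d f = 0"
        "\<forall>B. sum d B = sum d0 (B \<inter> (?E - ?F))" using extend[of "?E - ?F" d0] by blast
      have dk: "sum d B = k" if B: "?tight B" for B
      proof -
        have "B \<inter> (?E - ?F) = B - ?F" using B by (auto simp: spanning_tree_def)
        then show ?thesis
          using d(3) d0(4) spanning_tree_split(2)[OF within _ cardS[OF B]] B by simp
      qed
      have fg: "f \<in> ?E - ?F" "g \<in> ?E - ?F" using d0(1,2) by (simp_all add: contract_def)
      have "d f = d g" by (rule const_on[OF bspec[OF d(2)] dk cnF Diff_subset fg])
      then show False using d0(3) d(1) fg by simp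
    qed
    show ?thesis using two_ind two_con \<open>S \<subseteq> ?V\<close> cardS unfolding good_flat_def by blast
  qed
qed

section \<open>Facets of the cone over the base polytope\<close>

lemma inner_zero_on_span:
  assumes "\<And>p. p \<in> T \<Longrightarrow> y \<bullet> p = 0" and "x \<in> span T"
  shows "y \<bullet> x = 0"
proof -
  have "span T \<subseteq> {x. y \<bullet> x = 0}" by (intro span_minimal subspace_hyperplane) (use assms(1) in auto)
  then show ?thesis using assms(2) by blast
qed

text \<open>The face together with \<open>p\<close> must span the cone. If not, a nonzero vector of
  the span orthogonal to both is a form vanishing on the face, so a multiple of \<open>a\<close>;
  its value at \<open>p\<close> makes the factor 0, and the vector is orthogonal to itself.\<close>

lemma convex_cone_facetI:
  fixes C :: "'a::euclidean_space set"
  assumes C: "convex_cone C" and "\<And>x. x \<in> C \<Longrightarrow> 0 \<le> a \<bullet> x" and p: "p \<in> C" "a \<bullet> p \<noteq> 0"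
    and unique: "\<And>y. (\<And>x. x \<in> C \<Longrightarrow> a \<bullet> x = 0 \<Longrightarrow> y \<bullet> x = 0) \<Longrightarrow> \<exists>\<beta>. \<forall>x\<in>C. y \<bullet> x = \<beta> * (a \<bullet> x)"
  shows "(C \<inter> {x. a \<bullet> x = 0}) facet_of C"
proof -
  let ?F = "C \<inter> {x. a \<bullet> x = 0}"
  have conv: "convex C" and 0: "0 \<in> C" using C by (auto simp: convex_cone_def convex_cone_contains_0)
  have face: "?F face_of C" using assms(2) conv by (intro face_of_Int_supporting_hyperplane_ge)
  have "0 \<in> ?F" using 0 by simp
  then have dims: "aff_dim ?F = int (dim ?F)" "aff_dim C = int (dim C)"
    using 0 by (simp_all only: aff_dim_zero hull_inc)
  have "?F \<noteq> C" using p by blast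
  then have "aff_dim ?F < aff_dim C" by (rule face_of_aff_dim_lt[OF conv face])
  moreover have "dim C \<le> dim ?F + 1"
  proof -
    have sub: "span (insert p ?F) \<subseteq> span C" using p by (intro span_mono) auto
    have "span (insert p ?F) = span C"
    proof (rule ccontr)
      assume "span (insert p ?F) \<noteq> span C"
      then have "span (insert p ?F) \<subset> span C" using sub by blast
      then obtain x where x: "x \<noteq> 0" "x \<in> span C"
        "\<And>y. y \<in> span (insert p ?F) \<Longrightarrow> orthogonal x y"
        using orthogonal_to_subspace_exists_gen by metis
      have orth: "x \<bullet> y = 0" if "y \<in> insert p ?F" for y
        using x(3)[OF span_base[OF that]] by (simp add: orthogonal_def)
      then obtain \<beta> where \<beta>: "\<forall>y\<in>C. x \<bullet> y = \<beta> * (a \<bullet> y)" using unique[of x] by blast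
      then have "\<beta> = 0" using orth[of p] p by auto
      then have "x \<bullet> x = 0" using \<beta> x(2) by (intro inner_zero_on_span[of C x x]) auto
      then show False using x(1) by simp
    qed
    then have "dim C = dim (insert p ?F)" by (metis dim_span)
    also have "\<dots> \<le> dim ?F + 1" by (simp add: dim_insert)
    finally show ?thesis .
  qed
  ultimately show ?thesis using face \<open>0 \<in> ?F\<close> dims unfolding facet_of_def by auto
qed

text \<open>A facet and one point \<open>p\<close> of the cone off it span everything, so a form
  vanishing on the facet is determined by its value at \<open>p\<close>; that value fixes
  \<open>\<beta>\<close>.\<close>

lemma convex_cone_facetD:
  fixes C :: "'a::euclidean_space set"
  assumes C: "convex_cone C" and F: "F facet_of C" "F = C \<inter> {x. a \<bullet> x = 0}"
    and y: "\<And>x. x \<in> F \<Longrightarrow> y \<bullet> x = 0"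
  obtains \<beta> where "\<And>x. x \<in> span C \<Longrightarrow> y \<bullet> x = \<beta> * (a \<bullet> x)"
proof -
  have 0: "0 \<in> C" using C by (simp add: convex_cone_contains_0)
  then have "0 \<in> F" using F(2) by simp
  then have dims: "aff_dim F = int (dim F)" "aff_dim C = int (dim C)"
    using 0 by (simp_all only: aff_dim_zero hull_inc)
  then have dim: "dim C = dim F + 1" using F(1) unfolding facet_of_def by linarith
  then have "F \<noteq> C" by auto
  then obtain p where p: "p \<in> C" "a \<bullet> p \<noteq> 0" using F(2) by blast
  have "p \<notin> span F" using inner_zero_on_span[of F a p] p F(2) by blast
  then have "dim (insert p F) = dim C" using dim by (simp add: dim_insert)
  then have span: "span (insert p F) = span C" using p F(2) by (intro dim_eq_span) auto
  define \<beta> where "\<beta> = (y \<bullet> p) / (a \<bullet> p)"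
  have "(y - \<beta> *\<^sub>R a) \<bullet> x = 0" if "x \<in> span C" for x
  proof (rule inner_zero_on_span[of "insert p F"])
    fix q assume "q \<in> insert p F"
    then show "(y - \<beta> *\<^sub>R a) \<bullet> q = 0"
      using y F(2) p(2) by (auto simp: inner_diff_left \<beta>_def)
  qed (use that span in simp)
  then show thesis using that[of \<beta>] by (simp add: inner_diff_left)
qed

text \<open>Facets of polyhedra are exposed. The bound \<open>b\<close> of the supporting inequality
  is 0, since the cone contains 0 and, with a point \<open>x\<close> attaining \<open>b\<close>,
  also \<open>2 *\<^sub>R x\<close>.\<close>

lemma convex_cone_facet_exposed:
  fixes C :: "'a::euclidean_space set"
  assumes C: "convex_cone C" "polyhedron C" and F: "F facet_of C"
  obtains a where "\<And>x. x \<in> C \<Longrightarrow> a \<bullet> x \<le> 0" "F = C \<inter> {x. a \<bullet> x = 0}"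
proof -
  have "F exposed_face_of C" using F C(2) by (simp add: exposed_face_of_polyhedron facet_of_def)
  then obtain a b where ab: "C \<subseteq> {x. a \<bullet> x \<le> b}" "F = C \<inter> {x. a \<bullet> x = b}"
    unfolding exposed_face_of_def by blast
  have "0 \<in> C" using C(1) by (simp add: convex_cone_contains_0)
  then have "0 \<le> b" using ab(1) by auto
  obtain x where x: "x \<in> C" "a \<bullet> x = b" using F ab(2) by (auto simp: facet_of_def)
  then have "2 *\<^sub>R x \<in> C" using C(1) by (intro convex_cone_scaleR) auto
  then have "a \<bullet> (2 *\<^sub>R x) \<le> b" using ab(1) by blast
  then have "b \<le> 0" using x(2) by simp
  then have "b = 0" using \<open>0 \<le> b\<close> by simp
  then show thesis using that ab by blast
qed

text \<open>This places the lattice point in the dilated polytope. Each halfspace of a minimal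
  description supports a facet, so on the span its form is a multiple of the given \<open>g\<close>;
  the factor is nonpositive, as a point of the cone with positive \<open>g\<close> shows.\<close>

lemma polyhedral_cone_memI:
  fixes C :: "'a::euclidean_space set"
  assumes C: "convex_cone C" "polyhedron C" and z: "z \<in> span C"
    and facets: "\<And>F. F facet_of C \<Longrightarrow>
      \<exists>g. F = C \<inter> {x. g \<bullet> x = 0} \<and> (\<forall>x\<in>C. 0 \<le> g \<bullet> x) \<and> 0 < g \<bullet> z"
  shows "z \<in> C"
proof -
  obtain H where H: "finite H" "C = affine hull C \<inter> \<Inter>H"
    "\<forall>h\<in>H. \<exists>a b. a \<noteq> 0 \<and> h = {x. a \<bullet> x \<le> b}" "\<forall>H'. H' \<subset> H \<longrightarrow> C \<subset> affine hull C \<inter> \<Inter>H'"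
    using C(2) unfolding polyhedron_Int_affine_minimal by blast
  then obtain a b where ab: "\<And>h. h \<in> H \<Longrightarrow> a h \<noteq> 0 \<and> h = {x. a h \<bullet> x \<le> b h}" by metis
  have 0: "0 \<in> C" using C(1) by (simp add: convex_cone_contains_0)
  have "z \<in> h" if h: "h \<in> H" for h
  proof -
    define F where "F = C \<inter> {x. a h \<bullet> x = b h}"
    have F: "F facet_of C"
      using facet_of_polyhedron_explicit[OF H(1,2) ab, of F] H(4) h by (auto simp: F_def)
    then obtain g where g: "F = C \<inter> {x. g \<bullet> x = 0}" "\<forall>x\<in>C. 0 \<le> g \<bullet> x" "0 < g \<bullet> z"
      using facets by blast
    have "0 \<in> F" using g(1) 0 by simp
    then have b0: "b h = 0" by (simp add: F_def)
    then obtain \<beta> where \<beta>: "\<And>x. x \<in> span C \<Longrightarrow> a h \<bullet> x = \<beta> * (g \<bullet> x)"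
      using convex_cone_facetD[OF C(1) F g(1), of "a h"] by (auto simp: F_def)
    have "g \<noteq> 0" using g(3) by auto
    have "\<exists>x\<in>C. g \<bullet> x \<noteq> 0" using inner_zero_on_span[of C g z] g(3) z by fastforce
    then obtain x where x: "x \<in> C" "0 < g \<bullet> x" using g(2) by force
    have "x \<in> h" using x(1) H(2) h by blast
    then have "a h \<bullet> x \<le> 0" using ab[OF h] b0 by auto
    then have "\<beta> \<le> 0" using \<beta>[OF span_base[OF x(1)]] x(2) by (simp add: mult_le_0_iff)
    then have "a h \<bullet> z \<le> 0" using \<beta>[OF z] g(3) by (simp add: mult_le_0_iff)
    then show ?thesis using ab[OF h] b0 by auto
  qed
  moreover have "affine hull C = span C" using 0 by (simp add: affine_hull_span_0 hull_inc)
  ultimately show ?thesis using H(2) z by blast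
qed

section \<open>Linear forms evaluated at spanning trees\<close>

definition tree_point :: "'e set \<Rightarrow> (real ^ 'e) \<times> real" where
  "tree_point B = (indicator_vec B, 1)"

text \<open>Forms are stored as vectors acting by the inner product. At the point of a tree the
  value is the weight of the tree plus \<open>s\<close>, so forms on the cone and edge weightings
  with a constant are interchangeable.\<close>

definition form :: "('e \<Rightarrow> real) \<Rightarrow> real \<Rightarrow> (real ^ 'e) \<times> real" where
  "form c s = (vec_lambda c, s)"

lemma form_inner:
  fixes c :: "'e::finite \<Rightarrow> real"
  shows "form c s \<bullet> (x, t) = (\<Sum>e\<in>UNIV. c e * x $ e) + s * t"
  by (simp add: form_def inner_vec_def)

lemma form_tree_point:
  fixes c :: "'e::finite \<Rightarrow> real"
  shows "form c s \<bullet> tree_point B = sum c B + s"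
  by (simp add: tree_point_def form_inner indicator_vec_def)

lemma form_surj:
  fixes y :: "(real ^ 'e::finite) \<times> real"
  obtains c s where "y = form c s"
  using that[of "\<lambda>e. fst y $ e" "snd y"] by (simp add: form_def vec_lambda_eta)

lemma connected_has_edge:
  assumes "connected_graph H" and "2 \<le> card (verts H)"
  shows "edges H \<noteq> {}"
proof
  assume E: "edges H = {}"
  obtain u where u: "u \<in> verts H" using assms(1) by (auto simp: connected_graph_iff)
  have "verts H \<noteq> {u}" using assms(2) by auto
  then obtain v where v: "v \<in> verts H" "v \<noteq> u" using u by blast
  then have "reach (ends H) (edges H) u v" using assms(1) u by (simp add: connected_graph_iff connects_def)
  then show False by (rule reach_leaves[where U = "{u}"]) (use v E in auto)
qed

section \<open>The cone and the lattice generated by the spanning trees\<close>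

context
  fixes G :: "('v, 'e::finite) multigraph"
  assumes simple: "simple_graph G" and two_conn: "two_connected G" and all_edges: "edges G = UNIV"
begin

abbreviation (input) "base_cone \<equiv> cone_over (base_polytope G)"
abbreviation (input) "base_lattice \<equiv> homogenized_lattice (base_polytope G)"
abbreviation (input) "trees \<equiv> {B. spanning_tree G B}"
abbreviation (input) "tree_size \<equiv> real (card (verts G)) - 1"

lemma loopless_G: "loopless G"
  using simple by (rule simple_graph_loopless)

lemma conn_G: "connected_graph G" and card_G: "2 \<le> card (verts G)"
  using two_conn by (auto simp: two_connected_def)

lemma base_polytope_eq: "base_polytope G = convex hull (indicator_vec ` trees)"
  unfolding base_polytope_def spanning_forest_iff[OF loopless_G conn_G] by (simp add: setcompr_eq_image)

lemma polytope_at_height: "base_polytope G \<times> {1::real} = convex hull (tree_point ` trees)"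
proof -
  have "tree_point ` trees = (indicator_vec ` trees) \<times> {1::real}" by (auto simp: tree_point_def)
  then show ?thesis by (simp add: convex_hull_Times base_polytope_eq)
qed

lemma cone_eq: "base_cone = convex_cone hull (tree_point ` trees)"
proof -
  have "convex_cone hull (convex hull (tree_point ` trees)) = convex_cone hull (tree_point ` trees)"
  proof (rule antisym)
    show "convex_cone hull (convex hull (tree_point ` trees)) \<subseteq> convex_cone hull (tree_point ` trees)"
      by (intro hull_minimal convex_hull_subset_convex_cone_hull convex_cone_convex_cone_hull)
  qed (intro hull_mono hull_subset)
  then show ?thesis unfolding cone_over_def polytope_at_height .
qed

lemma convex_cone_cone: "convex_cone base_cone" and polyhedron_cone: "polyhedron base_cone"
  unfolding cone_eq by (auto intro: convex_cone_convex_cone_hull polyhedron_convex_cone_hull)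

lemma tree_point_in_cone: "spanning_tree G B \<Longrightarrow> tree_point B \<in> base_cone"
  unfolding cone_eq by (intro hull_inc) auto

lemma tree_exists: "\<exists>B. spanning_tree G B"
  using spanning_tree_exists[OF loopless_G subset_refl] conn_G by (auto simp: connected_graph_iff)

lemma tree_card: "spanning_tree G B \<Longrightarrow> real (card B) = tree_size"
  unfolding spanning_tree_def by linarith

lemma cone_sum:
  assumes "x \<in> base_cone"
  obtains l where "\<And>B. 0 \<le> l B" "x = (\<Sum>B\<in>trees. l B *\<^sub>R tree_point B)"
proof -
  have inj: "inj_on tree_point trees"
    by (auto simp: inj_on_def tree_point_def indicator_vec_def vec_eq_iff indicator_def split: if_splits)
  have "tree_point ` trees \<noteq> {}" using tree_exists by blast
  then obtain q k where q: "q \<in> convex hull (tree_point ` trees)" "0 \<le> k" "x = k *\<^sub>R q"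
    using assms unfolding cone_eq by (auto simp: convex_cone_hull_convex_hull_nonempty)
  then obtain u where u: "\<forall>p\<in>tree_point ` trees. 0 \<le> u p" "(\<Sum>p\<in>tree_point ` trees. u p *\<^sub>R p) = q"
    by (auto simp: convex_hull_finite)
  have "q = (\<Sum>B\<in>trees. u (tree_point B) *\<^sub>R tree_point B)"
    using u(2) by (simp add: sum.reindex[OF inj])
  \<comment> \<open>The coefficient is set to 0 off the trees so that nonnegativity holds for every
    \<open>B\<close> without a side condition.\<close>
  then have "x = (\<Sum>B\<in>trees. (if spanning_tree G B then k * u (tree_point B) else 0) *\<^sub>R tree_point B)"
    using q(3) by (simp add: scaleR_sum_right)
  then show thesis by (rule that[rotated]) (use u(1) q(2) in auto)
qed

lemma span_cone: "span base_cone = span (tree_point ` trees)"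
proof (rule antisym)
  have "base_cone \<subseteq> span (tree_point ` trees)"
  proof
    fix x assume "x \<in> base_cone"
    then obtain l where "x = (\<Sum>B\<in>trees. l B *\<^sub>R tree_point B)" by (rule cone_sum)
    then show "x \<in> span (tree_point ` trees)" by (auto intro: span_sum span_scale span_base)
  qed
  then show "span base_cone \<subseteq> span (tree_point ` trees)" by (intro span_minimal subspace_span)
  show "span (tree_point ` trees) \<subseteq> span base_cone" using tree_point_in_cone by (intro span_mono) blast
qed

lemma eq_on_span_cone:
  assumes "\<And>B. spanning_tree G B \<Longrightarrow> y \<bullet> tree_point B = z \<bullet> tree_point B" and "x \<in> span base_cone"
  shows "y \<bullet> x = z \<bullet> x"
proof -
  have "(y - z) \<bullet> p = 0" if "p \<in> tree_point ` trees" for p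
    using that assms(1) by (force simp: inner_diff_left)
  then have "(y - z) \<bullet> x = 0" using assms(2) unfolding span_cone by (rule inner_zero_on_span)
  then show ?thesis by (simp add: inner_diff_left)
qed

lemma nonneg_on_cone:
  assumes "\<And>B. spanning_tree G B \<Longrightarrow> 0 \<le> y \<bullet> tree_point B" and "x \<in> base_cone"
  shows "0 \<le> y \<bullet> x"
proof -
  obtain l where "\<And>B. 0 \<le> l B" "x = (\<Sum>B\<in>trees. l B *\<^sub>R tree_point B)"
    using cone_sum[OF assms(2)] by metis
  then show ?thesis using assms(1) by (auto simp: inner_sum_right intro!: sum_nonneg)
qed

text \<open>In a nonnegative combination of tree points the form \<open>a\<close> contributes only
  terms of one sign; if they sum to 0, only trees on the face occur with nonzero
  coefficient.\<close>

lemma zero_on_face: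
  assumes "\<And>B. spanning_tree G B \<Longrightarrow> a \<bullet> tree_point B \<le> 0"
    and "\<And>B. spanning_tree G B \<Longrightarrow> a \<bullet> tree_point B = 0 \<Longrightarrow> y \<bullet> tree_point B = 0"
    and "x \<in> base_cone" and "a \<bullet> x = 0"
  shows "y \<bullet> x = 0"
proof -
  obtain l where l: "\<And>B. 0 \<le> l B" "x = (\<Sum>B\<in>trees. l B *\<^sub>R tree_point B)"
    using cone_sum[OF assms(3)] by metis
  have "(\<Sum>B\<in>trees. - (l B * (a \<bullet> tree_point B))) = 0"
    using assms(4) l(2) by (simp add: inner_sum_right sum_negf)
  moreover have "0 \<le> - (l B * (a \<bullet> tree_point B))" if "B \<in> trees" for B
    using assms(1)[of B] l(1)[of B] that by (simp add: mult_le_0_iff)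
  ultimately have "l B * (a \<bullet> tree_point B) = 0" if "B \<in> trees" for B
    using that sum_nonneg_eq_0_iff[of trees "\<lambda>B. - (l B * (a \<bullet> tree_point B))"] by simp
  then have "l B * (y \<bullet> tree_point B) = 0" if "B \<in> trees" for B
    using assms(2)[of B] that by (metis mem_Collect_eq mult_eq_0_iff)
  then have "(\<Sum>B\<in>trees. l B * (y \<bullet> tree_point B)) = 0" by (intro sum.neutral) blast
  then show ?thesis unfolding l(2) by (simp add: inner_sum_right)
qed

lemma rigid: "(\<And>B. spanning_tree G B \<Longrightarrow> sum (c :: 'e \<Rightarrow> real) B = k) \<Longrightarrow> c e = c f"
  using two_connected_rigid[OF loopless_G two_conn] all_edges by blast

lemma tree_point_in_lattice: "spanning_tree G B \<Longrightarrow> tree_point B \<in> base_lattice"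
  unfolding homogenized_lattice_def
  by (intro group_closure.base)
    (auto simp: tree_point_def base_polytope_eq indicator_vec_def indicator_def intro!: hull_inc)

lemma lattice_integral: "(x, t) \<in> base_lattice \<Longrightarrow> x $ e \<in> \<int> \<and> t \<in> \<int>"
proof -
  have "fst p $ e \<in> \<int> \<and> snd p \<in> \<int>" if "p \<in> base_lattice" for p
    using that unfolding homogenized_lattice_def by (induction rule: group_closure.induct) auto
  then show "(x, t) \<in> base_lattice \<Longrightarrow> x $ e \<in> \<int> \<and> t \<in> \<int>" by force
qed

lemma lattice_subset_span: "base_lattice \<subseteq> span base_cone"
proof
  fix p assume "p \<in> base_lattice"
  then show "p \<in> span base_cone"
    unfolding homogenized_lattice_def
  proof (induction rule: group_closure.induct)
    case (base s)
    then have "s = 0 \<or> s \<in> base_polytope G \<times> {1}" by auto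
    moreover have "base_polytope G \<times> {1} \<subseteq> span base_cone"
      unfolding cone_over_def by (intro subset_trans[OF hull_subset span_superset])
    ultimately show ?case by (auto intro: span_zero)
  next
    case (diff s t)
    then show ?case by (intro span_diff)
  qed
qed

lemma lattice_diff: "p \<in> base_lattice \<Longrightarrow> q \<in> base_lattice \<Longrightarrow> p - q \<in> base_lattice"
  and lattice_add: "p \<in> base_lattice \<Longrightarrow> q \<in> base_lattice \<Longrightarrow> p + q \<in> base_lattice"
  and lattice_zero: "0 \<in> base_lattice"
  unfolding homogenized_lattice_def by (auto intro: group_closure.diff group_closure_add)

lemma lattice_scale_nat: "p \<in> base_lattice \<Longrightarrow> real n *\<^sub>R p \<in> base_lattice"
  by (induction n) (auto simp: lattice_zero lattice_add algebra_simps)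

lemma lattice_scale: "p \<in> base_lattice \<Longrightarrow> of_int k *\<^sub>R p \<in> base_lattice"
proof (cases "0 \<le> k")
  case True
  then show "p \<in> base_lattice \<Longrightarrow> ?thesis" using lattice_scale_nat[of p "nat k"] by simp
next
  case False
  then show "p \<in> base_lattice \<Longrightarrow> ?thesis"
    using lattice_diff[OF lattice_zero lattice_scale_nat[of p "nat (- k)"]] by simp
qed

lemma lattice_sum: "(\<And>i. i \<in> I \<Longrightarrow> f i \<in> base_lattice) \<Longrightarrow> sum f I \<in> base_lattice"
  by (induction I rule: infinite_finite_induct) (auto simp: lattice_zero lattice_add)

text \<open>Two trees that differ by trading \<open>f\<close> for \<open>e\<close> have this
  difference, and such differences add up along chains of edges.\<close>

lemma lattice_edge_diff: "(axis e 1 - axis f 1, 0) \<in> base_lattice"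
proof (rule two_connected_edges_related[OF loopless_G two_conn])
  fix e f g assume "(axis e 1 - axis f 1, 0) \<in> base_lattice" "(axis f 1 - axis g 1, 0) \<in> base_lattice"
  from lattice_add[OF this] show "(axis e 1 - axis g 1, 0) \<in> base_lattice" by simp
next
  fix e f B assume B: "e \<notin> B" "f \<notin> B" "spanning_tree G (insert e B)" "spanning_tree G (insert f B)"
  have "tree_point (insert e B) - tree_point (insert f B) = (axis e 1 - axis f 1, 0)"
    using B(1,2) by (auto simp: tree_point_def indicator_vec_def vec_eq_iff axis_def indicator_def)
  then show "(axis e 1 - axis f 1, 0) \<in> base_lattice"
    using lattice_diff tree_point_in_lattice B(3,4) by metis
qed (use all_edges in auto)

text \<open>Subtracting \<open>n\<close> copies of one tree leaves an integer vector with coordinate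
  sum 0, which is an integer combination of differences of unit vectors.\<close>

lemma lattice_mem:
  fixes w :: "'e \<Rightarrow> int"
  assumes "(\<Sum>e\<in>UNIV. w e) = int n * (int (card (verts G)) - 1)"
  shows "(\<chi> e. of_int (w e), real n) \<in> base_lattice"
proof -
  obtain B where B: "spanning_tree G B" using tree_exists by blast
  \<comment> \<open>Any edge serves as common subtrahend: its contributions cancel because the
    coefficients \<open>?m\<close> sum to 0.\<close>
  obtain f :: 'e where True by blast
  let ?m = "\<lambda>e. w e - int n * (if e \<in> B then 1 else 0)"
  have "(\<Sum>e\<in>UNIV. ?m e) = (\<Sum>e\<in>UNIV. w e) - int n * int (card B)"
    by (simp add: sum_subtractf sum_distrib_left[symmetric] sum.If_cases)
  also have "\<dots> = 0" using assms B by (simp add: spanning_tree_def flip: of_nat_diff)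
  finally have m0: "(\<Sum>e\<in>UNIV. ?m e) = 0" .
  have "(\<chi> e. of_int (w e), real n) =
    real n *\<^sub>R tree_point B + (\<Sum>e\<in>UNIV. of_int (?m e) *\<^sub>R (axis e 1 - axis f 1 :: real ^ 'e, 0))"
  proof -
    have "(\<Sum>e\<in>UNIV. of_int (?m e) * (axis e 1 - axis f 1 :: real ^ 'e) $ i) = of_int (?m i)" for i
    proof -
      have "(\<Sum>e\<in>UNIV. of_int (?m e) * (axis e 1 - axis f 1 :: real ^ 'e) $ i) =
        (\<Sum>e\<in>UNIV. of_int (?m e) * axis e 1 $ i) - (\<Sum>e\<in>UNIV. of_int (?m e)) * (axis f 1 :: real ^ 'e) $ i"
        by (simp only: vector_minus_component right_diff_distrib sum_subtractf sum_distrib_right)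
      also have "(\<Sum>e\<in>UNIV. of_int (?m e)) = (0 :: real)" using m0 by (simp only: of_int_0 flip: of_int_sum)
      also have "(\<Sum>e\<in>UNIV. of_int (?m e) * (axis e 1 :: real ^ 'e) $ i) = of_int (?m i)"
        by (simp add: axis_def if_distrib[of "(*) _"] sum.delta cong: if_cong)
      finally show ?thesis by simp
    qed
    then have "real n *\<^sub>R indicator_vec B + (\<Sum>e\<in>UNIV. of_int (?m e) *\<^sub>R (axis e 1 - axis f 1 :: real ^ 'e)) =
      (\<chi> e. of_int (w e))"
      by (simp add: vec_eq_iff indicator_vec_def indicator_def)
    moreover have "(\<Sum>e\<in>UNIV. of_int (?m e) *\<^sub>R (axis e 1 - axis f 1 :: real ^ 'e, 0 :: real)) =
      ((\<Sum>e\<in>UNIV. of_int (?m e) *\<^sub>R (axis e 1 - axis f 1 :: real ^ 'e)), 0)"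
      by (simp add: prod_eq_iff fst_sum snd_sum)
    ultimately show ?thesis by (simp add: tree_point_def)
  qed
  also have "\<dots> \<in> base_lattice"
    by (intro lattice_add lattice_sum lattice_scale lattice_scale_nat tree_point_in_lattice[OF B] lattice_edge_diff)
  finally show ?thesis .
qed

text \<open>Attaining 1 on the lattice stands for primitivity: it rules out every proper divisor at
  once and is checked by a single witness.\<close>

definition facet_form :: "(real ^ 'e) \<times> real \<Rightarrow> bool" where
  "facet_form g \<longleftrightarrow>
     (\<forall>x\<in>base_cone. 0 \<le> g \<bullet> x) \<and> (\<forall>x\<in>base_lattice. g \<bullet> x \<in> \<int>) \<and> (\<exists>x\<in>base_lattice. g \<bullet> x = 1) \<and>
     (base_cone \<inter> {x. g \<bullet> x = 0}) facet_of base_cone"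

lemma facet_form_reduced:
  assumes "facet_form g"
  shows "reduced_equation (base_polytope G) (base_cone \<inter> {x. g \<bullet> x = 0}) (\<lambda>x. g \<bullet> x)"
proof -
  obtain x where x: "x \<in> base_lattice" "g \<bullet> x = 1" using assms by (auto simp: facet_form_def)
  have "\<not> (\<forall>x\<in>base_lattice. g \<bullet> x / real k \<in> \<int>)" if "k > 1" for k :: nat
  proof
    assume "\<forall>x\<in>base_lattice. g \<bullet> x / real k \<in> \<int>"
    then obtain m where "1 / real k = of_int m" using x by (metis Ints_cases)
    moreover have "0 < 1 / real k" "1 / real k < 1" using that by auto
    ultimately show False by auto
  qed
  moreover have "linear (\<lambda>x. g \<bullet> x)" by (simp add: bounded_linear.linear bounded_linear_inner_right)
  ultimately show ?thesis
    using assms unfolding reduced_equation_def primitive_form_on_def facet_form_def by auto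
qed

text \<open>\<open>gorenstein\<close> provides only some reduced equation; it is a multiple
  \<open>\<beta>\<close> of \<open>g\<close> on the span. The factor is an integer because
  \<open>g\<close> attains 1, and nonnegative because both forms are nonnegative on the cone. A
  value 0 or above 1 contradicts primitivity, with divisor 2 or \<open>\<beta>\<close>.\<close>

lemma facet_form_unique:
  assumes g: "facet_form g" and h: "reduced_equation (base_polytope G) (base_cone \<inter> {x. g \<bullet> x = 0}) h"
    and "x \<in> base_lattice"
  shows "h x = g \<bullet> x"
proof -
  have lin: "linear h" and int: "\<forall>x\<in>base_lattice. h x \<in> \<int>"
    and prim: "\<And>k::nat. k > 1 \<Longrightarrow> \<not> (\<forall>x\<in>base_lattice. h x / real k \<in> \<int>)"
    and nonneg: "\<forall>x\<in>base_cone. 0 \<le> h x" and F: "base_cone \<inter> {x. g \<bullet> x = 0} = {x \<in> base_cone. h x = 0}"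
    using h unfolding reduced_equation_def primitive_form_on_def by auto
  \<comment> \<open>\<open>adjoint h 1\<close> is the vector that represents \<open>h\<close> by the
    inner product.\<close>
  have hy: "h x = adjoint h 1 \<bullet> x" for x
    using adjoint_works[OF lin, of x 1] by (simp add: inner_commute)
  obtain \<beta> where \<beta>: "\<And>x. x \<in> span base_cone \<Longrightarrow> h x = \<beta> * (g \<bullet> x)"
    using convex_cone_facetD[OF convex_cone_cone, of "base_cone \<inter> {x. g \<bullet> x = 0}" g "adjoint h 1"]
      g F unfolding facet_form_def hy[symmetric] by blast
  have L: "h x = \<beta> * (g \<bullet> x)" if "x \<in> base_lattice" for x using \<beta> that lattice_subset_span by blast
  obtain x1 where x1: "x1 \<in> base_lattice" "g \<bullet> x1 = 1" using g by (auto simp: facet_form_def)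
  then have "\<beta> \<in> \<int>" using int L[OF x1(1)] by auto
  then obtain m where m: "\<beta> = of_int m" by (rule Ints_cases)
  have "\<exists>p\<in>base_cone. g \<bullet> p \<noteq> 0"
    using inner_zero_on_span[of base_cone g x1] x1 lattice_subset_span by fastforce
  then obtain p where p: "p \<in> base_cone" "0 < g \<bullet> p" using g by (force simp: facet_form_def)
  then have "0 \<le> \<beta> * (g \<bullet> p)" using nonneg \<beta>[OF span_base] by metis
  then have "0 \<le> m" using p(2) m by (simp add: zero_le_mult_iff)
  have "m \<noteq> 0"
  proof
    assume "m = 0"
    then have "\<forall>x\<in>base_lattice. h x / real 2 \<in> \<int>" using L m by simp
    then show False using prim[of 2] by simp
  qed
  have "\<not> m > 1"
  proof
    assume "m > 1"
    then have "\<forall>x\<in>base_lattice. h x / real (nat m) \<in> \<int>" using L m g by (simp add: facet_form_def)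
    then show False using prim[of "nat m"] \<open>m > 1\<close> by simp
  qed
  then have "m = 1" using \<open>0 \<le> m\<close> \<open>m \<noteq> 0\<close> by simp
  then show ?thesis using L[OF assms(3)] m by simp
qed

text \<open>The facet criterion for cones, carried over to weightings \<open>c\<close> and constants
  \<open>s\<close> evaluated on spanning trees only.\<close>

lemma facet_formI:
  assumes nonneg: "\<And>B. spanning_tree G B \<Longrightarrow> 0 \<le> g \<bullet> tree_point B"
    and int: "\<And>x. x \<in> base_lattice \<Longrightarrow> g \<bullet> x \<in> \<int>" and l: "l \<in> base_lattice" "g \<bullet> l = 1"
    and unique: "\<And>c s. (\<And>B. spanning_tree G B \<Longrightarrow> g \<bullet> tree_point B = 0 \<Longrightarrow> sum c B + s = 0) \<Longrightarrow>
      \<exists>\<beta>. \<forall>B. spanning_tree G B \<longrightarrow> sum c B + s = \<beta> * (g \<bullet> tree_point B)"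
  shows "facet_form g"
proof -
  have "\<exists>p\<in>base_cone. g \<bullet> p \<noteq> 0"
    using inner_zero_on_span[of base_cone g l] l lattice_subset_span by fastforce
  then obtain p where p: "p \<in> base_cone" "g \<bullet> p \<noteq> 0" by blast
  have pos: "0 \<le> g \<bullet> x" if "x \<in> base_cone" for x using nonneg_on_cone[OF nonneg that] .
  have "(base_cone \<inter> {x. g \<bullet> x = 0}) facet_of base_cone"
  proof (rule convex_cone_facetI[OF convex_cone_cone pos p])
    fix y assume y: "\<And>x. x \<in> base_cone \<Longrightarrow> g \<bullet> x = 0 \<Longrightarrow> y \<bullet> x = 0"
    obtain c s where cs: "y = form c s" by (rule form_surj)
    have "\<exists>\<beta>. \<forall>B. spanning_tree G B \<longrightarrow> sum c B + s = \<beta> * (g \<bullet> tree_point B)"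
    proof (rule unique)
      fix B assume "spanning_tree G B" "g \<bullet> tree_point B = 0"
      then have "y \<bullet> tree_point B = 0" using y tree_point_in_cone by blast
      then show "sum c B + s = 0" by (simp add: cs form_tree_point)
    qed
    then obtain \<beta> where \<beta>: "\<And>B. spanning_tree G B \<Longrightarrow> sum c B + s = \<beta> * (g \<bullet> tree_point B)" by blast
    have "y \<bullet> x = (\<beta> *\<^sub>R g) \<bullet> x" if "x \<in> base_cone" for x
    proof (rule eq_on_span_cone[OF _ span_base[OF that]])
      fix B assume "spanning_tree G B"
      then show "y \<bullet> tree_point B = (\<beta> *\<^sub>R g) \<bullet> tree_point B" by (simp add: cs form_tree_point \<beta>)
    qed
    then show "\<exists>\<beta>. \<forall>x\<in>base_cone. y \<bullet> x = \<beta> * (g \<bullet> x)" by auto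
  qed
  then show ?thesis using pos int l unfolding facet_form_def by blast
qed

section \<open>The forms of edges and of good flats\<close>

definition edge_form :: "'e \<Rightarrow> (real ^ 'e) \<times> real" where
  "edge_form e = form (\<lambda>f. if f = e then 1 else 0) 0"

text \<open>The homogenized slack of the rank inequality for \<open>E(S)\<close>, whose rank is
  \<open>|S| - 1\<close> when the graph induced on \<open>S\<close> is connected.\<close>

definition flat_form :: "'v set \<Rightarrow> (real ^ 'e) \<times> real" where
  "flat_form S = form (\<lambda>e. if e \<in> edges_within G S then - 1 else 0) (real (card S) - 1)"

lemma edge_form_inner: "edge_form e \<bullet> (x, t) = x $ e"
  by (simp add: edge_form_def form_inner if_distrib[of "\<lambda>u. u * _"] sum.delta cong: if_cong)

lemma flat_form_inner:
  "flat_form S \<bullet> (x, t) = (real (card S) - 1) * t - (\<Sum>e\<in>edges_within G S. x $ e)"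
  by (simp add: flat_form_def form_inner if_distrib[of "\<lambda>u. u * _"] sum.If_cases sum_negf cong: if_cong)

lemma edge_form_tree: "edge_form e \<bullet> tree_point B = (if e \<in> B then 1 else 0)"
  by (simp add: tree_point_def edge_form_inner indicator_vec_def)

lemma flat_form_tree:
  "flat_form S \<bullet> tree_point B = real (card S) - 1 - real (card (B \<inter> edges_within G S))"
  by (simp add: tree_point_def flat_form_inner indicator_vec_def indicator_def sum.If_cases Int_def conj_commute)

lemma tree_through: "\<exists>B. spanning_tree G B \<and> e \<in> B"
proof -
  obtain v where v: "v \<in> ends G e" "v \<in> verts G"
    using loopless_ends[OF loopless_G] all_edges by (metis UNIV_I insertI1)
  then show ?thesis using two_connected_exchange[OF loopless_G two_conn v(2)] all_edges by blast
qed

lemma single_edge_tree: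
  assumes "UNIV = {e}" and "spanning_tree G B"
  shows "B = {e}"
proof -
  have "card B > 0" using assms(2) card_G by (simp add: spanning_tree_def)
  then have "B \<noteq> {}" by force
  moreover have "B \<subseteq> {e}" using assms(1) subset_UNIV[of B] by simp
  ultimately show ?thesis by blast
qed

text \<open>The trees on the face are those of the graph without \<open>e\<close>, so rigidity makes
  \<open>c\<close> constant off \<open>e\<close>. Since all trees have the same size, the form then
  depends only on whether \<open>e\<close> is in the tree. If \<open>e\<close> is the only edge, the
  cone is a ray and its apex is the facet.\<close>

lemma facet_form_edge:
  assumes "two_connected (delete_edge G e) \<or> UNIV = {e}"
  shows "facet_form (edge_form e)"
proof -
  obtain Be where Be: "spanning_tree G Be" "e \<in> Be" using tree_through by blast
  show ?thesis
  proof (rule facet_formI[of _ "tree_point Be"])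
    fix c :: "'e \<Rightarrow> real" and s
    assume *: "\<And>B. spanning_tree G B \<Longrightarrow> edge_form e \<bullet> tree_point B = 0 \<Longrightarrow> sum c B + s = 0"
    show "\<exists>\<beta>. \<forall>B. spanning_tree G B \<longrightarrow> sum c B + s = \<beta> * (edge_form e \<bullet> tree_point B)"
      using assms
    proof
      assume U: "UNIV = {e}"
      have "sum c B + s = (c e + s) * (edge_form e \<bullet> tree_point B)" if "spanning_tree G B" for B
        unfolding single_edge_tree[OF U that] by (simp add: edge_form_tree)
      then show ?thesis by blast
    next
      assume del: "two_connected (delete_edge G e)"
      have tr: "sum c B = - s" if "spanning_tree (delete_edge G e) B" for B
        using *[of B] that by (simp add: spanning_tree_delete_edge edge_form_tree eq_neg_iff_add_eq_0)
      have cc: "c f = c f'" if "f \<noteq> e" "f' \<noteq> e" for f f'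
        by (rule two_connected_rigid[OF loopless_delete_edge[OF loopless_G] del tr])
          (use that all_edges in \<open>auto simp: delete_edge_def\<close>)
      have "connected_graph (delete_edge G e)" using del by (simp add: two_connected_def)
      then obtain T where T: "spanning_tree (delete_edge G e) T"
        using spanning_tree_exists[OF loopless_delete_edge[OF loopless_G] subset_refl]
        unfolding connected_graph_iff by metis
      then have T': "spanning_tree G T" "e \<notin> T" by (auto simp: spanning_tree_delete_edge)
      have "card T > 0" using T' card_G by (simp add: spanning_tree_def)
      then obtain f where f: "f \<in> T" "f \<noteq> e" using T' by (metis card_gt_0_iff ex_in_conv)
      have cf: "c g = (if g = e then c e - c f else 0) + c f" for g
        using cc[of g f] f by simp
      have sumc: "sum c B = (if e \<in> B then c e - c f else 0) + tree_size * c f" if "spanning_tree G B" for B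
      proof -
        have "sum c B = (\<Sum>g\<in>B. (if g = e then c e - c f else 0) + c f)" by (intro sum.cong refl cf)
        then show ?thesis by (simp add: sum.distrib sum.delta tree_card[OF that])
      qed
      have "tree_size * c f + s = 0" using sumc[OF T'(1)] tr[OF T] T'(2) by simp
      then show ?thesis
        using sumc by (intro exI[of _ "c e - c f"]) (auto simp: edge_form_tree)
    qed
  next
    fix x assume "x \<in> base_lattice"
    then show "edge_form e \<bullet> x \<in> \<int>" using lattice_integral by (cases x) (simp add: edge_form_inner)
  qed (use Be in \<open>auto simp: edge_form_tree tree_point_in_lattice\<close>)
qed

lemma good_flat_facts:
  assumes "good_flat G S"
  shows "S \<subseteq> verts G" "S \<noteq> {}" "connects (ends G) S (edges_within G S)"
    "\<exists>e. e \<in> edges_within G S" "\<exists>e. e \<notin> edges_within G S"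
proof -
  have ind: "connected_graph (induced_subgraph G S)" "2 \<le> card (verts (induced_subgraph G S))"
    and con: "connected_graph (contract G (edges_within G S))"
      "2 \<le> card (verts (contract G (edges_within G S)))"
    using assms by (auto simp: good_flat_def two_connected_def)
  show "S \<subseteq> verts G" using assms by (simp add: good_flat_def)
  show "S \<noteq> {}" "connects (ends G) S (edges_within G S)"
    using ind by (auto simp: connected_graph_iff induced_subgraph_def)
  show "\<exists>e. e \<in> edges_within G S"
    using connected_has_edge[OF ind] by (auto simp: induced_subgraph_def)
  show "\<exists>e. e \<notin> edges_within G S"
    using connected_has_edge[OF con] by (auto simp: contract_def)
qed

text \<open>Trees on the face include all unions of a tree of the induced subgraph and one of the
  contraction. Varying one part with the other fixed and using rigidity, \<open>c\<close> has one
  value inside \<open>E(S)\<close> and one outside, so its tree sum depends only on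
  \<open>|B \<inter> E(S)|\<close>.\<close>

lemma facet_form_flat:
  assumes "good_flat G S"
  shows "facet_form (flat_form S)"
proof -
  let ?F = "edges_within G S"
  note facts = good_flat_facts[OF assms]
  note within = loopless_G facts(1,2,3)
  obtain e0 f0 where e0: "e0 \<in> ?F" "f0 \<notin> ?F" using facts by blast
  have two: "two_connected (induced_subgraph G S)" "two_connected (contract G ?F)"
    using assms by (auto simp: good_flat_def)
  have ll: "loopless (induced_subgraph G S)" "loopless (contract G ?F)"
    using loopless_induced_subgraph[OF loopless_G facts(1)] loopless_contract_within[OF within] .
  obtain T1 where T1: "spanning_tree (induced_subgraph G S) T1"
    using spanning_tree_exists[OF ll(1) subset_refl] two(1) unfolding two_connected_def connected_graph_iff by metis
  obtain T2 where T2: "spanning_tree (contract G ?F) T2"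
    using spanning_tree_exists[OF ll(2) subset_refl] two(2) unfolding two_connected_def connected_graph_iff by metis
  have union: "spanning_tree G (B1 \<union> B2) \<and> flat_form S \<bullet> tree_point (B1 \<union> B2) = 0 \<and>
      B1 \<inter> B2 = {}"
    if B: "spanning_tree (induced_subgraph G S) B1" "spanning_tree (contract G ?F) B2" for B1 B2
  proof -
    have "B1 \<subseteq> ?F" "B2 \<inter> ?F = {}" "card B1 + 1 = card S"
      using B by (auto simp: spanning_tree_def induced_subgraph_def contract_def)
    moreover from this have "(B1 \<union> B2) \<inter> ?F = B1" "B1 \<inter> B2 = {}" by auto
    ultimately show ?thesis using spanning_tree_union[OF within B] by (simp add: flat_form_tree)
  qed
  show ?thesis
  proof (rule facet_formI[of _ "(axis f0 1 - axis e0 1, 0)"])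
    fix B assume "spanning_tree G B"
    then show "0 \<le> flat_form S \<bullet> tree_point B"
      using spanning_tree_split(1)[OF within, of B] unfolding flat_form_tree by linarith
  next
    fix x assume "x \<in> base_lattice"
    then show "flat_form S \<bullet> x \<in> \<int>"
      using lattice_integral by (cases x) (auto simp: flat_form_inner intro!: Ints_diff Ints_mult Ints_sum)
  next
    \<comment> \<open>The witness trades an edge inside \<open>E(S)\<close> for one outside, which
      raises the slack by exactly one.\<close>
    show "(axis f0 1 - axis e0 1, 0) \<in> base_lattice" by (rule lattice_edge_diff)
    show "flat_form S \<bullet> (axis f0 1 - axis e0 1, 0) = 1"
      using e0 by (simp add: flat_form_inner sum_subtractf axis_def sum.delta)
  next
    fix c :: "'e \<Rightarrow> real" and s
    assume *: "\<And>B. spanning_tree G B \<Longrightarrow> flat_form S \<bullet> tree_point B = 0 \<Longrightarrow> sum c B + s = 0"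
    have sum0: "sum c B1 + sum c B2 + s = 0"
      if B: "spanning_tree (induced_subgraph G S) B1" "spanning_tree (contract G ?F) B2" for B1 B2
      using *[of "B1 \<union> B2"] union[OF B] by (simp add: sum.union_disjoint)
    have c1: "c e = c e0" if "e \<in> ?F" for e
    proof (rule two_connected_rigid[OF ll(1) two(1)])
      show "sum c B = - sum c T2 - s" if "spanning_tree (induced_subgraph G S) B" for B
        using sum0[OF that T2] by linarith
    qed (use that e0 in \<open>auto simp: induced_subgraph_def\<close>)
    have c2: "c e = c f0" if "e \<notin> ?F" for e
    proof (rule two_connected_rigid[OF ll(2) two(2)])
      show "sum c B = - sum c T1 - s" if "spanning_tree (contract G ?F) B" for B
        using sum0[OF T1 that] by linarith
    qed (use that e0 all_edges in \<open>auto simp: contract_def\<close>)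
    have cf: "c g = (if g \<in> ?F then c e0 - c f0 else 0) + c f0" for g
      using c1[of g] c2[of g] by simp
    have sumc: "sum c B = real (card (B \<inter> ?F)) * (c e0 - c f0) + tree_size * c f0"
      if "spanning_tree G B" for B
    proof -
      have "sum c B = (\<Sum>g\<in>B. (if g \<in> ?F then c e0 - c f0 else 0) + c f0)" by (intro sum.cong refl cf)
      then show ?thesis by (simp add: sum.distrib sum.If_cases tree_card[OF that] Int_def)
    qed
    have T: "spanning_tree G (T1 \<union> T2)" "flat_form S \<bullet> tree_point (T1 \<union> T2) = 0"
      using union[OF T1 T2] by auto
    have z: "(real (card S) - 1) * (c e0 - c f0) + tree_size * c f0 + s = 0"
      using *[OF T] sumc[OF T(1)] T(2) by (simp add: flat_form_tree)
    have "sum c B + s = (c f0 - c e0) * (flat_form S \<bullet> tree_point B)" if "spanning_tree G B" for B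
      using sumc[OF that] z unfolding flat_form_tree by (simp add: algebra_simps)
    then show "\<exists>\<beta>. \<forall>B. spanning_tree G B \<longrightarrow> sum c B + s = \<beta> * (flat_form S \<bullet> tree_point B)" by blast
  qed
qed

text \<open>The exposing form \<open>a\<close> is read as a weighting \<open>c\<close>, whose
  maximal trees are those on the facet. The graph with one edge is treated apart, since a
  nonconstant weighting needs two edges.\<close>

lemma facet_classification:
  assumes F: "F facet_of base_cone"
  shows "\<exists>g. facet_form g \<and> F = base_cone \<inter> {x. g \<bullet> x = 0} \<and>
    ((\<exists>e. (two_connected (delete_edge G e) \<or> UNIV = {e}) \<and> g = edge_form e) \<or>
     (\<exists>S. good_flat G S \<and> g = flat_form S))"
proof -
  obtain a where a: "\<And>x. x \<in> base_cone \<Longrightarrow> a \<bullet> x \<le> 0" "F = base_cone \<inter> {x. a \<bullet> x = 0}"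
    using convex_cone_facet_exposed[OF convex_cone_cone polyhedron_cone F] by metis
  obtain c s where cs: "a = form c s" by (rule form_surj)
  have aB: "a \<bullet> tree_point B = sum c B + s" for B by (simp add: cs form_tree_point)
  have le: "sum c B \<le> - s" if "spanning_tree G B" for B
    using a(1)[OF tree_point_in_cone[OF that]] aB[of B] by linarith
  have "F \<noteq> base_cone" using F by (auto simp: facet_of_def)
  then have "\<exists>x\<in>base_cone. a \<bullet> x \<noteq> 0" using a(2) by blast
  then have anz: "\<exists>B. spanning_tree G B \<and> a \<bullet> tree_point B \<noteq> 0"
    using eq_on_span_cone[of a 0] by (metis inner_zero_left span_base)
  have ann: "\<exists>\<beta>. \<forall>x\<in>span base_cone. y \<bullet> x = \<beta> * (a \<bullet> x)"
    if y: "\<And>B. spanning_tree G B \<Longrightarrow> a \<bullet> tree_point B = 0 \<Longrightarrow> y \<bullet> tree_point B = 0" for y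
  proof -
    have "y \<bullet> x = 0" if "x \<in> F" for x
    proof (rule zero_on_face[OF _ y])
      show "x \<in> base_cone" "a \<bullet> x = 0" using that a(2) by auto
    qed (use a(1) tree_point_in_cone in blast)
    then show ?thesis using convex_cone_facetD[OF convex_cone_cone F a(2)] by metis
  qed
  \<comment> \<open>A facet form vanishing on the trees of \<open>F\<close> is a multiple of
    \<open>a\<close> on the span, and a nonzero one as it attains 1; hence it cuts out the same
    facet.\<close>
  have conclude: "facet_form g \<Longrightarrow> F = base_cone \<inter> {x. g \<bullet> x = 0}"
    if g0: "\<And>B. spanning_tree G B \<Longrightarrow> a \<bullet> tree_point B = 0 \<Longrightarrow> g \<bullet> tree_point B = 0" for g
  proof -
    assume g: "facet_form g"
    obtain \<beta> where \<beta>: "\<forall>x\<in>span base_cone. g \<bullet> x = \<beta> * (a \<bullet> x)" using ann[OF g0] by blast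
    obtain l where "l \<in> base_lattice" "g \<bullet> l = 1" using g by (auto simp: facet_form_def)
    then have "\<beta> \<noteq> 0" using \<beta> lattice_subset_span by fastforce
    then show ?thesis using \<beta> a(2) by (auto simp: span_base)
  qed
  show ?thesis
  proof (cases "\<exists>e :: 'e. UNIV = {e}")
    case True
    then obtain e :: 'e where e: "UNIV = {e}" by blast
    have B: "B = {e}" if "spanning_tree G B" for B using single_edge_tree[OF e that] .
    have "facet_form (edge_form e)" using facet_form_edge e by blast
    moreover have "F = base_cone \<inter> {x. edge_form e \<bullet> x = 0}"
      by (rule conclude[OF _ calculation]) (use anz B in auto)
    ultimately show ?thesis using e by blast
  next
    case False
    then obtain e1 e2 :: 'e where e12: "e1 \<noteq> e2" by blast
    \<comment> \<open>If no tree lay on the facet, every form would be a multiple of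
      \<open>a\<close> on the span. The height and the coordinate \<open>e1\<close> would then be
      proportional, so all trees would agree about containing \<open>e1\<close>, against rigidity
      for two edges.\<close>
    have tight: "\<exists>B. spanning_tree G B \<and> sum c B = - s"
    proof (rule ccontr)
      assume n: "\<not> ?thesis"
      have nz: "a \<bullet> tree_point B \<noteq> 0" if "spanning_tree G B" for B
        using n that aB[of B] by (auto simp: eq_neg_iff_add_eq_0)
      obtain \<beta> where \<beta>: "\<forall>x\<in>span base_cone. form (\<lambda>_. 0) 1 \<bullet> x = \<beta> * (a \<bullet> x)"
        using ann[of "form (\<lambda>_. 0) 1"] nz by blast
      obtain \<gamma> where \<gamma>: "\<forall>x\<in>span base_cone. edge_form e1 \<bullet> x = \<gamma> * (a \<bullet> x)"
        using ann[of "edge_form e1"] nz by blast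
      have "sum (\<lambda>e. if e = e1 then 1 else 0) B = \<gamma> / \<beta>" if B: "spanning_tree G B" for B
      proof -
        have sp: "tree_point B \<in> span base_cone" using B by (intro span_base tree_point_in_cone)
        have "1 = \<beta> * (a \<bullet> tree_point B)" using bspec[OF \<beta> sp] by (simp add: form_tree_point)
        moreover from this have "\<beta> \<noteq> 0" by auto
        ultimately have "a \<bullet> tree_point B = 1 / \<beta>" by (simp add: field_simps)
        then show ?thesis using bspec[OF \<gamma> sp] by (simp add: edge_form_def form_tree_point)
      qed
      from rigid[OF this, of e1 e2] show False using e12 by simp
    qed
    then obtain B0 where B0: "spanning_tree G B0" "sum c B0 = - s" by blast
    have "\<exists>e f. c e \<noteq> c f"
    proof (rule ccontr)
      assume "\<not> ?thesis"
      then have "c e = c e1" for e by blast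
      then have "sum c B = tree_size * c e1" if "spanning_tree G B" for B
        using tree_card[OF that] by (metis (mono_tags, lifting) sum_constant sum.cong)
      then show False using anz B0 aB by fastforce
    qed
    then obtain e0 f0 where e0: "c e0 \<noteq> c f0" by blast
    \<comment> \<open>On the span \<open>form d (- k)\<close> is a multiple \<open>\<beta>\<close>
      of \<open>a\<close>, so \<open>d - \<beta> c\<close> has constant sum over all spanning trees
      and is itself constant by rigidity.\<close>
    have unique: "\<exists>\<beta> t. \<forall>e\<in>edges G. d e = \<beta> * c e + t"
      if d: "\<And>B. spanning_tree G B \<Longrightarrow> sum c B = - s \<Longrightarrow> sum d B = k" for d k
    proof -
      obtain \<beta> where \<beta>: "\<forall>x\<in>span base_cone. form d (- k) \<bullet> x = \<beta> * (a \<bullet> x)"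
        using ann[of "form d (- k)"] d by (auto simp: form_tree_point aB)
      have "sum (\<lambda>e. d e - \<beta> * c e) B = k + \<beta> * s" if B: "spanning_tree G B" for B
      proof -
        have sp: "tree_point B \<in> span base_cone" using B by (intro span_base tree_point_in_cone)
        show ?thesis using bspec[OF \<beta> sp]
          by (simp add: form_tree_point aB sum_subtractf sum_distrib_left algebra_simps)
      qed
      from rigid[OF this, of _ e0] have "d e = \<beta> * c e + (d e0 - \<beta> * c e0)" for e
        by (metis add_diff_cancel_left' diff_add_cancel diff_diff_eq2 add.commute)
      then show ?thesis by blast
    qed
    have "(\<exists>e\<in>edges G. two_connected (delete_edge G e) \<and>
        (\<forall>B. spanning_tree G B \<longrightarrow> sum c B = - s \<longrightarrow> e \<notin> B)) \<or>
      (\<exists>S. good_flat G S \<and>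
        (\<forall>B. spanning_tree G B \<longrightarrow> sum c B = - s \<longrightarrow> card (B \<inter> edges_within G S) + 1 = card S))"
    proof (rule tight_trees_classification[OF simple two_conn le B0 _ _ e0])
      show "e0 \<in> edges G" "f0 \<in> edges G" using all_edges by simp_all
      fix d :: "'e \<Rightarrow> real" and k
      assume "\<And>B. spanning_tree G B \<Longrightarrow> sum c B = - s \<Longrightarrow> sum d B = k"
      then show "\<exists>\<beta> t. \<forall>e\<in>edges G. d e = \<beta> * c e + t" by (rule unique)
    qed
    then show ?thesis
    proof (elim disjE bexE exE conjE)
      fix e
      assume e: "two_connected (delete_edge G e)"
        "\<forall>B. spanning_tree G B \<longrightarrow> sum c B = - s \<longrightarrow> e \<notin> B"
      have g: "facet_form (edge_form e)" using facet_form_edge e(1) by blast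
      have "F = base_cone \<inter> {x. edge_form e \<bullet> x = 0}"
      proof (rule conclude[OF _ g])
        fix B assume "spanning_tree G B" "a \<bullet> tree_point B = 0"
        then have "e \<notin> B" using e(2) aB[of B] by (simp add: eq_neg_iff_add_eq_0)
        then show "edge_form e \<bullet> tree_point B = 0" by (simp add: edge_form_tree)
      qed
      then show ?thesis using g e(1) by blast
    next
      fix S
      assume S: "good_flat G S"
        "\<forall>B. spanning_tree G B \<longrightarrow> sum c B = - s \<longrightarrow> card (B \<inter> edges_within G S) + 1 = card S"
      have g: "facet_form (flat_form S)" by (rule facet_form_flat[OF S(1)])
      have "F = base_cone \<inter> {x. flat_form S \<bullet> x = 0}"
      proof (rule conclude[OF _ g])
        fix B assume "spanning_tree G B" "a \<bullet> tree_point B = 0"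
        then have "card (B \<inter> edges_within G S) + 1 = card S"
          using S(2) aB[of B] by (simp add: eq_neg_iff_add_eq_0)
        then show "flat_form S \<bullet> tree_point B = 0" unfolding flat_form_tree by linarith
      qed
      then show ?thesis using g S(1) by blast
    qed
  qed
qed

text \<open>The coordinates of \<open>v\<close> are the weights, integers because \<open>v\<close>
  is a lattice point. Evaluating the forms of edges and flats at \<open>v\<close> gives the
  conditions, and the dichotomy between deletion and contraction leaves only the two values.\<close>

lemma gorenstein_imp_weight:
  assumes "gorenstein \<delta> (base_polytope G)"
  shows "\<exists>w :: 'e \<Rightarrow> int.
       (\<forall>e\<in>edges G. w e \<in> {1, int \<delta> - 1}) \<and>
       (\<forall>e\<in>edges G. two_connected (delete_edge G e) \<longrightarrow> w e = 1) \<and>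
       (\<forall>e\<in>edges G. two_connected (contract G {e}) \<longrightarrow> w e = int \<delta> - 1) \<and>
       (\<Sum>e\<in>edges G. w e) = int \<delta> * (int (card (verts G)) - 1) \<and>
       (\<forall>S. good_flat G S \<longrightarrow>
          (\<Sum>e\<in>edges_within G S. w e) + 1 = int \<delta> * (int (card S) - 1))"
proof -
  obtain v where v: "(v, real \<delta>) \<in> base_lattice"
    and h: "\<And>F. F facet_of base_cone \<Longrightarrow> \<exists>h. reduced_equation (base_polytope G) F h \<and> h (v, real \<delta>) = 1"
    using assms by (auto simp: gorenstein_def)
  have one: "g \<bullet> (v, real \<delta>) = 1" if "facet_form g" for g
    using h[of "base_cone \<inter> {x. g \<bullet> x = 0}"] facet_form_unique[OF that _ v] that
    unfolding facet_form_def by metis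
  define w where "w e = \<lfloor>v $ e\<rfloor>" for e
  have w: "v $ e = of_int (w e)" for e using lattice_integral[OF v, of e] by (simp add: w_def)
  have del: "w e = 1" if "two_connected (delete_edge G e) \<or> UNIV = {e}" for e
    using one[OF facet_form_edge[OF that]] by (simp add: edge_form_inner w)
  have flat: "(\<Sum>e\<in>edges_within G S. w e) + 1 = int \<delta> * (int (card S) - 1)" if "good_flat G S" for S
  proof -
    have "real_of_int ((\<Sum>e\<in>edges_within G S. w e) + 1) = real_of_int (int \<delta> * (int (card S) - 1))"
      using one[OF facet_form_flat[OF that]] by (simp add: flat_form_inner w algebra_simps)
    then show ?thesis by (simp only: of_int_eq_iff)
  qed
  have con: "w e = int \<delta> - 1" if "two_connected (contract G {e})" for e
  proof -
    have "good_flat G (ends G e)" using edge_good_flat[OF simple] all_edges that by blast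
    moreover have "card (ends G e) = 2" using simple all_edges by (simp add: simple_graph_def)
    ultimately show ?thesis
      using flat[of "ends G e"] simple_edges_within_ends[OF simple, of e] all_edges by simp
  qed
  have "w e \<in> {1, int \<delta> - 1}" for e
  proof (cases "3 \<le> card (verts G)")
    case True
    then show ?thesis
      using contract_or_delete_two_connected[OF simple two_conn True, of e] all_edges del con by blast
  next
    case False
    \<comment> \<open>With only two vertices a simple graph has no edge besides \<open>e\<close>, so
      the facet form of the single edge applies.\<close>
    have "ends G e = verts G"
    proof (rule card_subset_eq)
      show "finite (verts G)" "ends G e \<subseteq> verts G" "card (ends G e) = card (verts G)"
        using simple all_edges False card_G by (auto simp: simple_graph_def)
    qed
    then have "edges_within G (ends G e) = UNIV"
      using simple all_edges by (auto simp: edges_within_def simple_graph_def)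
    then have "UNIV = {e}" using simple_edges_within_ends[OF simple, of e] all_edges by simp
    then show ?thesis using del by blast
  qed
  moreover have "(\<Sum>e\<in>edges G. w e) = int \<delta> * (int (card (verts G)) - 1)"
  proof -
    \<comment> \<open>The form \<open>x(E) - (|V| - 1) t\<close> vanishes on all trees, hence on the
      whole span, which contains the lattice.\<close>
    have "form (\<lambda>_. 1) (- tree_size) \<bullet> (v, real \<delta>) = 0 \<bullet> (v, real \<delta>)"
      by (rule eq_on_span_cone) (use lattice_subset_span v in \<open>auto simp: form_tree_point tree_card\<close>)
    then have "(\<Sum>e\<in>UNIV. real_of_int (w e)) = real \<delta> * tree_size" by (simp add: form_inner w algebra_simps)
    then have "real_of_int (\<Sum>e\<in>UNIV. w e) = real_of_int (int \<delta> * (int (card (verts G)) - 1))" by simp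
    then show ?thesis unfolding all_edges by (simp only: of_int_eq_iff)
  qed
  ultimately show ?thesis using del con flat by blast
qed

text \<open>With \<open>v\<close> the vector of weights, the total puts it into the lattice, and the
  remaining conditions say that every facet form is 1 there, as the facets are classified.\<close>

lemma weight_imp_gorenstein:
  fixes w :: "'e \<Rightarrow> int"
  assumes w1: "\<And>e. w e \<in> {1, int \<delta> - 1}"
    and del: "\<And>e. two_connected (delete_edge G e) \<Longrightarrow> w e = 1"
    and total: "(\<Sum>e\<in>UNIV. w e) = int \<delta> * (int (card (verts G)) - 1)"
    and flat: "\<And>S. good_flat G S \<Longrightarrow>
      (\<Sum>e\<in>edges_within G S. w e) + 1 = int \<delta> * (int (card S) - 1)"
  shows "gorenstein \<delta> (base_polytope G)"
proof -
  define v :: "real ^ 'e" where "v = (\<chi> e. of_int (w e))"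
  have L: "(v, real \<delta>) \<in> base_lattice" using lattice_mem[OF total] by (simp add: v_def)
  have form: "\<exists>g. facet_form g \<and> F = base_cone \<inter> {x. g \<bullet> x = 0} \<and> g \<bullet> (v, real \<delta>) = 1"
    if "F facet_of base_cone" for F
  proof -
    obtain g where g: "facet_form g" "F = base_cone \<inter> {x. g \<bullet> x = 0}"
      and alt: "(\<exists>e. (two_connected (delete_edge G e) \<or> UNIV = {e}) \<and> g = edge_form e) \<or>
        (\<exists>S. good_flat G S \<and> g = flat_form S)"
      using facet_classification[OF \<open>F facet_of base_cone\<close>] by blast
    have "g \<bullet> (v, real \<delta>) = 1"
      using alt
    proof (elim disjE exE conjE)
      fix e assume e: "g = edge_form e" and "two_connected (delete_edge G e)"
      then show ?thesis using del by (simp add: edge_form_inner v_def)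
    next
      fix e :: 'e assume e: "g = edge_form e" and U: "UNIV = {e}"
      \<comment> \<open>The total weight gives \<open>w e = \<delta>\<close>, which differs from
        \<open>\<delta> - 1\<close>; so the restriction to two values leaves 1.\<close>
      have "w e = 1"
      proof -
        obtain B where B: "spanning_tree G B" "e \<in> B" using tree_through by blast
        have "B = {e}" using B(2) U by blast
        then have "card (verts G) = 2" using B(1) by (simp add: spanning_tree_def)
        then have "w e = int \<delta>" using total by (simp add: U)
        then show ?thesis using w1[of e] by auto
      qed
      then show ?thesis using e by (simp add: edge_form_inner v_def)
    next
      fix S assume S: "good_flat G S" and gS: "g = flat_form S"
      have "real_of_int ((\<Sum>e\<in>edges_within G S. w e) + 1) = real_of_int (int \<delta> * (int (card S) - 1))"
        using flat[OF S] by simp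
      then show ?thesis unfolding gS by (simp add: flat_form_inner v_def algebra_simps)
    qed
    then show ?thesis using g by blast
  qed
  \<comment> \<open>Value 1 on every facet means positivity on every facet, hence membership in the
    cone; comparing heights afterwards puts \<open>v\<close> into the dilate of the polytope by
    \<delta>.\<close>
  have "(v, real \<delta>) \<in> base_cone"
  proof (rule polyhedral_cone_memI[OF convex_cone_cone polyhedron_cone])
    show "(v, real \<delta>) \<in> span base_cone" using L lattice_subset_span by blast
    fix F assume "F facet_of base_cone"
    then show "\<exists>g. F = base_cone \<inter> {x. g \<bullet> x = 0} \<and> (\<forall>x\<in>base_cone. 0 \<le> g \<bullet> x) \<and> 0 < g \<bullet> (v, real \<delta>)"
      using form[of F] unfolding facet_form_def by (metis zero_less_one)
  qed
  then have "(v, real \<delta>) \<in> convex_cone hull (convex hull (tree_point ` trees))"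
    unfolding cone_over_def polytope_at_height .
  moreover have "tree_point ` trees \<noteq> {}" using tree_exists by blast
  ultimately obtain q k where q: "q \<in> convex hull (tree_point ` trees)" "(v, real \<delta>) = k *\<^sub>R q"
    by (auto simp: convex_cone_hull_convex_hull_nonempty hull_hull)
  then have "q \<in> base_polytope G \<times> {1}" by (simp add: polytope_at_height)
  then obtain x where x: "x \<in> base_polytope G" "q = (x, 1)" by auto
  then have "v \<in> (\<lambda>x. real \<delta> *\<^sub>R x) ` base_polytope G" using q(2) by auto
  moreover have "\<exists>h. reduced_equation (base_polytope G) F h \<and> h (v, real \<delta>) = 1"
    if "F facet_of base_cone" for F
    using form[OF that] facet_form_reduced by blast
  ultimately show ?thesis unfolding gorenstein_def using L by blast
qed

end

theorem theorem3p1: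
  fixes G :: "('v, 'e::finite) multigraph" and \<delta> :: nat
  assumes "0 < \<delta>"
    and "simple_graph G" and "two_connected G"
    and "edges G = UNIV"
  shows "gorenstein \<delta> (base_polytope G) \<longleftrightarrow>
    (\<exists>w :: 'e \<Rightarrow> int.
       (\<forall>e\<in>edges G. w e \<in> {1, int \<delta> - 1}) \<and>
       (\<forall>e\<in>edges G. two_connected (delete_edge G e) \<longrightarrow> w e = 1) \<and>
       (\<forall>e\<in>edges G. two_connected (contract G {e}) \<longrightarrow> w e = int \<delta> - 1) \<and>
       (\<Sum>e\<in>edges G. w e) = int \<delta> * (int (card (verts G)) - 1) \<and>
       (\<forall>S. good_flat G S \<longrightarrow>
          (\<Sum>e\<in>edges_within G S. w e) + 1 = int \<delta> * (int (card S) - 1)))"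
proof
  assume "gorenstein \<delta> (base_polytope G)"
  then show "\<exists>w :: 'e \<Rightarrow> int.
       (\<forall>e\<in>edges G. w e \<in> {1, int \<delta> - 1}) \<and>
       (\<forall>e\<in>edges G. two_connected (delete_edge G e) \<longrightarrow> w e = 1) \<and>
       (\<forall>e\<in>edges G. two_connected (contract G {e}) \<longrightarrow> w e = int \<delta> - 1) \<and>
       (\<Sum>e\<in>edges G. w e) = int \<delta> * (int (card (verts G)) - 1) \<and>
       (\<forall>S. good_flat G S \<longrightarrow>
          (\<Sum>e\<in>edges_within G S. w e) + 1 = int \<delta> * (int (card S) - 1))"
    by (rule gorenstein_imp_weight[OF assms(2-4)])
next
  assume "\<exists>w :: 'e \<Rightarrow> int.
       (\<forall>e\<in>edges G. w e \<in> {1, int \<delta> - 1}) \<and>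
       (\<forall>e\<in>edges G. two_connected (delete_edge G e) \<longrightarrow> w e = 1) \<and>
       (\<forall>e\<in>edges G. two_connected (contract G {e}) \<longrightarrow> w e = int \<delta> - 1) \<and>
       (\<Sum>e\<in>edges G. w e) = int \<delta> * (int (card (verts G)) - 1) \<and>
       (\<forall>S. good_flat G S \<longrightarrow>
          (\<Sum>e\<in>edges_within G S. w e) + 1 = int \<delta> * (int (card S) - 1))"
  then show "gorenstein \<delta> (base_polytope G)"
  proof (elim exE conjE)
    fix w :: "'e \<Rightarrow> int"
    assume w: "\<forall>e\<in>edges G. w e \<in> {1, int \<delta> - 1}"
      "\<forall>e\<in>edges G. two_connected (delete_edge G e) \<longrightarrow> w e = 1"
      "(\<Sum>e\<in>edges G. w e) = int \<delta> * (int (card (verts G)) - 1)"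
      "\<forall>S. good_flat G S \<longrightarrow> (\<Sum>e\<in>edges_within G S. w e) + 1 = int \<delta> * (int (card S) - 1)"
    show ?thesis
    proof (rule weight_imp_gorenstein[OF assms(2-4)])
      show "w e \<in> {1, int \<delta> - 1}" "two_connected (delete_edge G e) \<Longrightarrow> w e = 1" for e
        using w(1,2) by (simp_all add: assms(4))
      show "(\<Sum>e\<in>UNIV. w e) = int \<delta> * (int (card (verts G)) - 1)" using w(3) assms(4) by simp
      show "(\<Sum>e\<in>edges_within G S. w e) + 1 = int \<delta> * (int (card S) - 1)" if "good_flat G S" for S
        using w(4) that by simp
    qed
  qed
qed

end
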